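(* Let $n\ge1$. The class $\mathcal{L}^{\mathrm{Bog.}}(n)=\bigcup_m\mathcal{L}^{\mathrm{Bog.}}(n,m)$ of systems $G=(\tilde S,\tilde C,\tilde\Omega)$ with $n$ field channels and any number $m$ of oscillator modes is a group with respect to the series product $$G_2\triangleleft G_1=\big(\tilde S_2\tilde S_1,\ \tilde C_2+\tilde S_2\tilde C_1,\ \tilde\Omega_1+\tilde\Omega_2+\mathrm{Im}_\flat\{\tilde C_2^\flat\tilde S_2\tilde C_1\}\big),\qquad G_j=(\tilde S_j,\tilde C_j,\tilde\Omega_j),$$ and the following are subgroups: the class $\mathcal{L}^{\mathrm{HP}}(n)=\bigcup_m\mathcal{L}^{\mathrm{HP}}(n,m)$; the group $\mathrm{Sp}(\mathbb{C}^n)$, identified with the systems $(\tilde S,0,0)$; and $U(n)$, identified with the systems $(\Delta(S,0),0,0)$, $S\in U(n)$. The inverse of $G=(\tilde S,\tilde C,\tilde\Omega)$ is $$G^{-1}=(\tilde S^\flat,-\tilde S^\flat\tilde C,-\tilde\Omega),$$ and its transfer function is $$\tilde\Xi_{G^{-1}}(s)=\tilde\Xi_G(s^\ast)^\flat,$$ where $s^\ast$ is the complex conjugate of $s$.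
   Context: For a complex matrix $X$, $X^\#$ is the entrywise complex conjugate and $X^\dagger$ the conjugate transpose. For $E_-,E_+\in\mathbb{C}^{r\times k}$, the doubled-up matrix is $$\Delta(E_-,E_+)=\begin{bmatrix} E_- & E_+ \\ E_+^\# & E_-^\# \end{bmatrix}\in\mathbb{C}^{2r\times2k}.$$ Let $J_n=\begin{bmatrix} I_n & 0 \\ 0 & -I_n \end{bmatrix}$; for a $2n\times2m$ matrix $X$ put $X^\flat=J_mX^\dagger J_n$, and for a square matrix $X$ of even size put $\mathrm{Im}_\flat X=\frac1{2i}(X-X^\flat)$. $\mathrm{Sp}(\mathbb{C}^n)$ is the group of $2n\times2n$ matrices $\tilde S$ of doubled-up form $\Delta(S_-,S_+)$ with $\tilde S^\flat\tilde S=\tilde S\tilde S^\flat=I$. $U(n)$ is the group of $n\times n$ unitary matrices. $\mathcal{L}^{\mathrm{Bog.}}(n,m)$ is the class of linear systems with $n$ input fields and $m$ oscillator modes parameterized by triples $G=(\tilde S,\tilde C,\tilde\Omega)$ with $\tilde S\in\mathrm{Sp}(\mathbb{C}^n)$, $\tilde C=\Delta(C_-,C_+)$ for some $C_\pm\in\mathbb{C}^{n\times m}$, and $-i\tilde\Omega=-\Delta(i\Omega_-,i\Omega_+)$ for some $\Omega_\pm\in\mathbb{C}^{m\times m}$ with $\Omega_-^\dagger=\Omega_-$ and $\Omega_+^\top=\Omega_+$ (equivalently, $-i\tilde\Omega$ is of doubled-up form and $\tilde\Omega^\flat=\tilde\Omega$). $\mathcal{L}^{\mathrm{HP}}(n,m)$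 is the subclass with $\tilde S=\Delta(S,0)$, $S\in U(n)$. The two systems in a series product may have the same modes, some modes in common, or entirely different modes. In the product formula both are written with respect to a common collection of modes containing the modes of each: $C_\pm$ is given zero columns, and $\Omega_\pm$ zero rows and columns, for the modes on which the system does not depend. (For example, systems with $m_1$ and $m_2$ distinct modes are both written as systems on $m_1+m_2$ modes.) A system is not distinguished from its version extended by zeros in this way. The transfer function of $G$ is $$\tilde\Xi_G(s)=\tilde S-\tilde C(sI-\tilde A)^{-1}\tilde C^\flat\tilde S,\qquad \tilde A=-\tfrac12\tilde C^\flat\tilde C-i\tilde\Omega,$$ for complex $s$ at which the inverse exists. *)

theory Defs
  imports
    Complex_Main
    "HOL-Library.Infinite_Typeclass"
    "HOL-Algebra.Coset"
    "Jordan_Normal_Form.Matrix"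
    "Jordan_Normal_Form.Schur_Decomposition"
    "Jordan_Normal_Form.Gauss_Jordan_Elimination"
begin

section \<open>Doubled-up matrices\<close>

definition conj_mat :: "complex mat \<Rightarrow> complex mat" where
  "conj_mat X = map_mat cnj X"

definition Delta :: "complex mat \<Rightarrow> complex mat \<Rightarrow> complex mat" where
  "Delta Em Ep = four_block_mat Em Ep (conj_mat Ep) (conj_mat Em)"

definition J_mat :: "nat \<Rightarrow> complex mat" where
  "J_mat n = four_block_mat (1\<^sub>m n) (0\<^sub>m n n) (0\<^sub>m n n) (- 1\<^sub>m n)"

definition flat :: "complex mat \<Rightarrow> complex mat" where
  "flat X = J_mat (dim_col X div 2) * mat_adjoint X * J_mat (dim_row X div 2)"

definition Im_flat :: "complex mat \<Rightarrow> complex mat" where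
  "Im_flat X = (1 / (2 * \<i>)) \<cdot>\<^sub>m (X - flat X)"

definition Sp :: "nat \<Rightarrow> complex mat set" where
  "Sp n = {S. (\<exists>Sm\<in>carrier_mat n n. \<exists>Sq\<in>carrier_mat n n. S = Delta Sm Sq)
              \<and> flat S * S = 1\<^sub>m (2 * n) \<and> S * flat S = 1\<^sub>m (2 * n)}"

definition U_mats :: "nat \<Rightarrow> complex mat set" where
  "U_mats n = {S \<in> carrier_mat n n. mat_adjoint S * S = 1\<^sub>m n \<and> S * mat_adjoint S = 1\<^sub>m n}"

definition Sp_group :: "nat \<Rightarrow> complex mat monoid" where
  "Sp_group n = \<lparr>carrier = Sp n, monoid.mult = (*), one = 1\<^sub>m (2 * n)\<rparr>"

definition U_group :: "nat \<Rightarrow> complex mat monoid" where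
  "U_group n = \<lparr>carrier = U_mats n, monoid.mult = (*), one = 1\<^sub>m n\<rparr>"

section \<open>Linear systems\<close>

text \<open>
  A system carries, besides its triple of matrices, the list of names of its modes: the
  \<open>k\<close>-th name says which oscillator the \<open>k\<close>-th columns of \<open>C\<^sub>-\<close> and \<open>C\<^sub>+\<close> (and the \<open>k\<close>-th
  rows and columns of \<open>\<Omega>\<^sub>-\<close> and \<open>\<Omega>\<^sub>+\<close>) belong to. The names make it meaningful for two
  systems to have all, some or none of their modes in common.
\<close>

datatype 'l lsys =
  LSys (modes: "'l list") (scat: "complex mat") (coup: "complex mat") (ham: "complex mat")

definition Bog_nm :: "nat \<Rightarrow> nat \<Rightarrow> 'l lsys set" where
  "Bog_nm n m = {G. distinct (modes G) \<and> length (modes G) = m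
     \<and> scat G \<in> Sp n
     \<and> (\<exists>Cm\<in>carrier_mat n m. \<exists>Cp\<in>carrier_mat n m. coup G = Delta Cm Cp)
     \<and> (\<exists>Om\<in>carrier_mat m m. \<exists>Op\<in>carrier_mat m m.
          mat_adjoint Om = Om \<and> transpose_mat Op = Op
          \<and> (- \<i>) \<cdot>\<^sub>m ham G = - Delta (\<i> \<cdot>\<^sub>m Om) (\<i> \<cdot>\<^sub>m Op))}"

definition HP_nm :: "nat \<Rightarrow> nat \<Rightarrow> 'l lsys set" where
  "HP_nm n m = {G \<in> Bog_nm n m. \<exists>S\<in>U_mats n. scat G = Delta S (0\<^sub>m n n)}"

definition Bog :: "nat \<Rightarrow> 'l lsys set" where
  "Bog n = (\<Union>m. Bog_nm n m)"

definition HP :: "nat \<Rightarrow> 'l lsys set" where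
  "HP n = (\<Union>m. HP_nm n m)"

section \<open>Extension by zeros\<close>

definition pos :: "'l list \<Rightarrow> 'l \<Rightarrow> nat" where
  "pos ms l = (THE k. k < length ms \<and> ms ! k = l)"

definition pad_cols :: "'l list \<Rightarrow> 'l list \<Rightarrow> complex mat \<Rightarrow> complex mat" where
  "pad_cols ms ms' X = mat (dim_row X) (length ms')
     (\<lambda>(i, j). if ms' ! j \<in> set ms then X $$ (i, pos ms (ms' ! j)) else 0)"

definition pad_rows :: "'l list \<Rightarrow> 'l list \<Rightarrow> complex mat \<Rightarrow> complex mat" where
  "pad_rows ms ms' X = mat (length ms') (dim_col X)
     (\<lambda>(i, j). if ms' ! i \<in> set ms then X $$ (pos ms (ms' ! i), j) else 0)"

definition map_blocks ::
  "nat \<Rightarrow> nat \<Rightarrow> (complex mat \<Rightarrow> complex mat) \<Rightarrow> complex mat \<Rightarrow> complex mat" where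
  "map_blocks r k f X =
     (case split_block X r k of (A, B, C, D) \<Rightarrow> four_block_mat (f A) (f B) (f C) (f D))"

text \<open>
  \<open>zero_ext ms' G\<close> writes \<open>G\<close> with respect to a distinct list \<open>ms'\<close> of modes containing those
  of \<open>G\<close>. The doubled-up matrices are padded block by block. If \<open>ms'\<close> contains no further
  modes this is a mere reordering of the modes.
\<close>

definition zero_ext :: "'l list \<Rightarrow> 'l lsys \<Rightarrow> 'l lsys" where
  "zero_ext ms' G = (let ms = modes G; m = length ms in
     LSys ms' (scat G)
       (map_blocks (dim_row (coup G) div 2) m (pad_cols ms ms') (coup G))
       (map_blocks m m (\<lambda>X. pad_rows ms ms' (pad_cols ms ms' X)) (ham G)))"

definition same_sys :: "nat \<Rightarrow> ('l lsys \<times> 'l lsys) set" where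
  "same_sys n = {(G, H). G \<in> Bog n \<and> H \<in> Bog n \<and>
     (\<exists>ms. distinct ms \<and> set (modes G) \<subseteq> set ms \<and> set (modes H) \<subseteq> set ms
           \<and> zero_ext ms G = zero_ext ms H)}"

definition sys_class :: "nat \<Rightarrow> 'l lsys \<Rightarrow> 'l lsys set" where
  "sys_class n G = same_sys n `` {G}"

section \<open>Series product, inverse, transfer function\<close>

text \<open>Only meant for systems written with respect to the same list of modes.\<close>

definition series :: "'l lsys \<Rightarrow> 'l lsys \<Rightarrow> 'l lsys" (infixl "\<triangleleft>" 70) where
  "G2 \<triangleleft> G1 = LSys (modes G1)
     (scat G2 * scat G1)
     (coup G2 + scat G2 * coup G1)
     (ham G1 + ham G2 + Im_flat (flat (coup G2) * scat G2 * coup G1))"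

text \<open>\<open>(S, 0, 0)\<close> with no modes; by extension by zeros it is the same as \<open>(S, 0, 0)\<close> with any modes.\<close>

definition static :: "complex mat \<Rightarrow> 'l lsys" where
  "static S = LSys [] S (0\<^sub>m (dim_row S) 0) (0\<^sub>m 0 0)"

definition sys_inv :: "'l lsys \<Rightarrow> 'l lsys" where
  "sys_inv G = LSys (modes G) (flat (scat G)) (- (flat (scat G) * coup G)) (- ham G)"

text \<open>
  The elements are the systems modulo extension by zeros. Any two classes have members that
  are written with respect to the same list of modes; these are multiplied by the formula.
\<close>

definition Bog_group :: "nat \<Rightarrow> 'l lsys set monoid" where
  "Bog_group n =
     \<lparr>carrier = Bog n // same_sys n,
      monoid.mult = (\<lambda>X2 X1. \<Union>{sys_class n (G2 \<triangleleft> G1) | G2 G1.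
                          G2 \<in> X2 \<and> G1 \<in> X1 \<and> modes G2 = modes G1}),
      one = sys_class n (static (1\<^sub>m (2 * n)))\<rparr>"

definition A_mat :: "'l lsys \<Rightarrow> complex mat" where
  "A_mat G = (- (1 / 2)) \<cdot>\<^sub>m (flat (coup G) * coup G) - \<i> \<cdot>\<^sub>m ham G"

text \<open>The value is \<open>None\<close> exactly when \<open>sI - A\<close> is not invertible.\<close>

definition transfer :: "'l lsys \<Rightarrow> complex \<Rightarrow> complex mat option" where
  "transfer G s = map_option
     (\<lambda>R. scat G - coup G * R * flat (coup G) * scat G)
     (mat_inverse (s \<cdot>\<^sub>m 1\<^sub>m (2 * length (modes G)) - A_mat G))"

end

(* Extension by zeros is the congruence C |-> C E, Omega |-> E^flat Omega E with a 0/1 isometry E,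
   so it commutes with the series product, and the group laws only need to be checked for systems
   on a common list of modes, where they follow from flat being an involutive anti-automorphism.
   The inverse system has resolvent s - A' = (s^* - A)^flat, which gives its transfer function. *)
theory Submission
  imports Defs
begin

section \<open>Matrix identities\<close>

text \<open>Padding is defined entry by entry through mode names; rewriting it as multiplication by
  E is what turns the group laws into matrix algebra. Commutation with the series product then comes
  from the shape of the cross term: couplings enter it only as C2^flat ... C1, so the factors E^flat
  and E move to the outside. Transfer functions are more delicate. E E^flat = 1, but E^flat E is
  only a projection, and each added mode contributes a plain s to s - A. Two representatives of one
  class can therefore have resolvents at different points: at s = 0 one may have a transfer function
  while the other has none. So the formula for the inverse is an equality of partial functions for
  \<open>sys_inv G\<close>, and for any other representative it compares values at points where both
  exist. The comparison must not invert s - A on the common list of modes, where it can be singular;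
  solutions of one linear equation from the left and one from the right replace the inverse.\<close>

lemma assoc_mult_mat_dim:
  fixes A B C :: "'a::semiring_0 mat"
  assumes "dim_col A = dim_row B" "dim_col B = dim_row C"
  shows "A * B * C = A * (B * C)"
  using assms by (intro assoc_mult_mat[of _ "dim_row A" "dim_col A" _ "dim_col B" _ "dim_col C"]) auto

lemma assoc_add_mat_dim:
  fixes A B C :: "'a::semigroup_add mat"
  assumes "dim_row B = dim_row C" "dim_col B = dim_col C"
  shows "A + B + C = A + (B + C)"
  using assms by (intro eq_matI) (auto simp: add.assoc)

lemma add_mult_distrib_mat_dim:
  fixes A B C :: "'a::semiring_0 mat"
  assumes "dim_row A = dim_row B" "dim_col A = dim_col B" "dim_col B = dim_row C"
  shows "(A + B) * C = A * C + B * C"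
  using assms by (intro add_mult_distrib_mat[of _ "dim_row A" "dim_col A" _ _ "dim_col C"]) auto

lemma mult_add_distrib_mat_dim:
  fixes A B C :: "'a::semiring_0 mat"
  assumes "dim_row B = dim_row C" "dim_col B = dim_col C" "dim_col A = dim_row C"
  shows "A * (B + C) = A * B + A * C"
  using assms by (intro mult_add_distrib_mat[of _ "dim_row A" "dim_col A" _ "dim_col C"]) auto

lemma minus_mult_distrib_mat_dim:
  fixes A B C :: "'a::ring mat"
  assumes "dim_row A = dim_row B" "dim_col A = dim_col B" "dim_col B = dim_row C"
  shows "(A - B) * C = A * C - B * C"
  using assms by (intro minus_mult_distrib_mat[of _ "dim_row A" "dim_col A" _ _ "dim_col C"]) auto

lemma mult_minus_distrib_mat_dim:
  fixes A B C :: "'a::ring mat"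
  assumes "dim_row B = dim_row C" "dim_col B = dim_col C" "dim_col A = dim_row C"
  shows "A * (B - C) = A * B - A * C"
  using assms by (intro mult_minus_distrib_mat[of _ "dim_row A" "dim_col A" _ "dim_col C"]) auto

lemma smult_mult_mat_dim:
  fixes A B :: "'a::comm_ring mat"
  assumes "dim_col A = dim_row B"
  shows "(c \<cdot>\<^sub>m A) * B = c \<cdot>\<^sub>m (A * B)" "A * (c \<cdot>\<^sub>m B) = c \<cdot>\<^sub>m (A * B)"
  using assms by (auto intro!: eq_matI)

text \<open>Side conditions of these rules are equations between dimensions, which
  \<open>simp\<close> settles by evaluation; carrier versions would leave intermediate sizes to be
  guessed. The rules multiply out and associate to the right.\<close>

lemmas mat_dim_simps =
  assoc_mult_mat_dim add_mult_distrib_mat_dim mult_add_distrib_mat_dim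
  minus_mult_distrib_mat_dim mult_minus_distrib_mat_dim smult_mult_mat_dim

lemma mult_one_mat_dim:
  fixes A :: "'a::semiring_1 mat"
  shows "dim_row A = n \<Longrightarrow> 1\<^sub>m n * A = A" "dim_col A = n \<Longrightarrow> A * 1\<^sub>m n = A"
  by auto

lemma add_zero_mat_dim:
  fixes A :: "'a::monoid_add mat"
  assumes "dim_row A = r" "dim_col A = k"
  shows "A + 0\<^sub>m r k = A" "0\<^sub>m r k + A = A"
  using assms by auto

lemma mult_zero_mat_dim:
  fixes A :: "'a::semiring_0 mat"
  shows "dim_row A = k \<Longrightarrow> 0\<^sub>m r k * A = 0\<^sub>m r (dim_col A)"
    "dim_col A = k \<Longrightarrow> A * 0\<^sub>m k r = 0\<^sub>m (dim_row A) r"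
  by auto

text \<open>In a right-associated product the factors A and B are never adjacent as a term
  \<open>A * B\<close>; this form lets a known inverse pair cancel there.\<close>

lemma mult_mat_cancel_left:
  fixes A B X :: "'a::semiring_1 mat"
  assumes "A * B = 1\<^sub>m n" "dim_col A = dim_row B" "dim_row X = n" "dim_col B = n"
  shows "A * (B * X) = X"
proof -
  have "A * (B * X) = A * B * X"
    using assms(2-4) by (simp add: assoc_mult_mat_dim)
  then show ?thesis
    using assms by (simp add: mult_one_mat_dim)
qed

lemma mat_adjoint_eq: "mat_adjoint A = map_mat cnj (transpose_mat A)"
  unfolding mat_adjoint_def
  by (rule eq_matI) (auto simp: mat_of_rows_def cols_def conjugate_vec_def col_def)

section \<open>Entrywise conjugate, adjoint and the matrix J\<close>

lemma conj_mat_dim [simp]: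
  "dim_row (conj_mat A) = dim_row A" "dim_col (conj_mat A) = dim_col A"
  by (auto simp: conj_mat_def)

lemma conj_mat_carrier [simp]: "conj_mat A \<in> carrier_mat r k \<longleftrightarrow> A \<in> carrier_mat r k"
  by (simp add: conj_mat_def)

lemma conj_mat_conj_mat [simp]: "conj_mat (conj_mat A) = A"
  by (rule eq_matI) (simp_all add: conj_mat_def)

lemma conj_mat_add:
  assumes "A \<in> carrier_mat r k" "B \<in> carrier_mat r k"
  shows "conj_mat (A + B) = conj_mat A + conj_mat B"
  using assms by (auto simp: conj_mat_def)

lemma conj_mat_mult:
  assumes "A \<in> carrier_mat r k" "B \<in> carrier_mat k l"
  shows "conj_mat (A * B) = conj_mat A * conj_mat B"
  using assms by (intro eq_matI) (auto simp: conj_mat_def scalar_prod_def intro!: sum.cong)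

lemma conj_mat_zero [simp]: "conj_mat (0\<^sub>m r k) = 0\<^sub>m r k"
  by (auto simp: conj_mat_def)

lemma conj_mat_one [simp]: "conj_mat (1\<^sub>m k) = 1\<^sub>m k"
  by (auto simp: conj_mat_def)

lemma mat_adjoint_mult:
  fixes A B :: "complex mat"
  assumes "dim_col A = dim_row B"
  shows "mat_adjoint (A * B) = mat_adjoint B * mat_adjoint A"
  unfolding mat_adjoint_eq using assms
  by (intro eq_matI) (auto simp: scalar_prod_def mult.commute)

lemma mat_adjoint_dim [simp]:
  fixes A :: "complex mat"
  shows "dim_row (mat_adjoint A) = dim_col A" "dim_col (mat_adjoint A) = dim_row A"
  by (auto simp: mat_adjoint_eq)

lemma mat_adjoint_adjoint [simp]: "mat_adjoint (mat_adjoint A) = (A :: complex mat)"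
  by (auto simp: mat_adjoint_eq)

lemma J_mat_dim [simp]: "dim_row (J_mat n) = 2 * n" "dim_col (J_mat n) = 2 * n"
  by (auto simp: J_mat_def)

lemma mat_adjoint_J [simp]: "mat_adjoint (J_mat n) = J_mat n"
  by (rule eq_matI) (auto simp: mat_adjoint_eq J_mat_def)

lemma J_mat_J: "J_mat n * J_mat n = 1\<^sub>m (2 * n)"
proof -
  have "- 0\<^sub>m n n = (0\<^sub>m n n :: complex mat)"
    by auto
  then have "J_mat n * J_mat n = four_block_mat (1\<^sub>m n) (0\<^sub>m n n) (0\<^sub>m n n) (1\<^sub>m n)"
    unfolding J_mat_def
    by (subst mult_four_block_mat[of _ n n _ n _ n _ _ n _ n])
      auto
  then show ?thesis by (simp add: mult_2)
qed

section \<open>The involution \<open>flat\<close>\<close>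

text \<open>The halving rounds down, so \<open>flat\<close> loses a row or column of a matrix with
  odd dimensions; hence the parity assumptions in the rules below.\<close>

lemma flat_dim [simp]:
  "dim_row (flat A) = 2 * (dim_col A div 2)" "dim_col (flat A) = 2 * (dim_row A div 2)"
  by (auto simp: flat_def)

lemma flat_carrier: "A \<in> carrier_mat (2 * r) (2 * k) \<Longrightarrow> flat A \<in> carrier_mat (2 * k) (2 * r)"
  by auto

text \<open>On the right-hand side two copies of \<open>J_mat\<close> for the shared dimension meet
  in the middle and cancel.\<close>

lemma flat_mult:
  assumes "dim_col A = dim_row B" "even (dim_row A)" "even (dim_row B)" "even (dim_col B)"
  shows "flat (A * B) = flat B * flat A"
proof -
  note J = mult_mat_cancel_left[OF J_mat_J]
  show ?thesis
    using assms by (simp add: flat_def mat_adjoint_mult assoc_mult_mat_dim J)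
qed

lemma flat_flat:
  assumes "even (dim_row A)" "even (dim_col A)"
  shows "flat (flat A) = A"
proof -
  note J = mult_mat_cancel_left[OF J_mat_J]
  show ?thesis
    using assms by (simp add: flat_def mat_adjoint_mult assoc_mult_mat_dim J J_mat_J mult_one_mat_dim)
qed

lemma flat_add:
  assumes "dim_row A = dim_row B" "dim_col A = dim_col B" "even (dim_row B)" "even (dim_col B)"
  shows "flat (A + B) = flat A + flat B"
proof -
  have "mat_adjoint (A + B) = mat_adjoint A + mat_adjoint B"
    using assms by (auto simp: mat_adjoint_eq)
  then show ?thesis using assms by (simp add: flat_def mat_dim_simps)
qed

lemma flat_smult:
  assumes "even (dim_row A)" "even (dim_col A)"
  shows "flat (c \<cdot>\<^sub>m A) = cnj c \<cdot>\<^sub>m flat A"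
proof -
  have "mat_adjoint (c \<cdot>\<^sub>m A) = cnj c \<cdot>\<^sub>m mat_adjoint A"
    by (auto simp: mat_adjoint_eq)
  then show ?thesis using assms by (simp add: flat_def mat_dim_simps)
qed

lemma uminus_eq_smult_mat: "- A = (-1 :: 'a::ring_1) \<cdot>\<^sub>m A"
  by auto

lemma flat_uminus:
  assumes "even (dim_row A)" "even (dim_col A)"
  shows "flat (- A) = - flat A"
  using flat_smult[OF assms, of "-1"] by (simp add: uminus_eq_smult_mat)

lemma flat_minus:
  assumes "dim_row A = dim_row B" "dim_col A = dim_col B" "even (dim_row B)" "even (dim_col B)"
  shows "flat (A - B) = flat A - flat B"
proof -
  have "A - B = A + - B" using assms by auto
  then have "flat (A - B) = flat A + - flat B"
    using assms by (simp add: flat_add flat_uminus)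
  also have "\<dots> = flat A - flat B" using assms by auto
  finally show ?thesis .
qed

lemma flat_one [simp]: "flat (1\<^sub>m (2 * n)) = 1\<^sub>m (2 * n)"
proof -
  have "mat_adjoint (1\<^sub>m (2 * n)) = (1\<^sub>m (2 * n) :: complex mat)"
    by (rule eq_matI) (auto simp: mat_adjoint_eq)
  then show ?thesis by (simp add: flat_def mult_one_mat_dim J_mat_J)
qed

lemma flat_zero [simp]: "flat (0\<^sub>m (2 * n) (2 * m)) = 0\<^sub>m (2 * m) (2 * n)"
proof -
  have "0\<^sub>m (2 * n) (2 * m) = (0 :: complex) \<cdot>\<^sub>m 0\<^sub>m (2 * n) (2 * m)"
    by auto
  then have "flat (0\<^sub>m (2 * n) (2 * m)) = 0 \<cdot>\<^sub>m flat (0\<^sub>m (2 * n) (2 * m))"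
    using flat_smult[of "0\<^sub>m (2 * n) (2 * m)" 0] by simp
  also have "\<dots> = 0\<^sub>m (2 * m) (2 * n)"
    by auto
  finally show ?thesis .
qed

section \<open>Doubled-up form\<close>

text \<open>This set is closed under sums, products, \<open>flat\<close> and real multiples, but not
  under multiplication by i, since the lower blocks carry the conjugate scalar. Hamiltonians are
  therefore tracked through \<open>\<i> \<cdot>\<^sub>m H\<close>.\<close>

definition doubled :: "nat \<Rightarrow> nat \<Rightarrow> complex mat set" where
  "doubled r k = {Delta A B | A B. A \<in> carrier_mat r k \<and> B \<in> carrier_mat r k}"

lemma Delta_dim [simp]:
  "dim_row (Delta A B) = 2 * dim_row A" "dim_col (Delta A B) = 2 * dim_col A"
  by (auto simp: Delta_def)

lemma Delta_in_doubled: "A \<in> carrier_mat r k \<Longrightarrow> B \<in> carrier_mat r k \<Longrightarrow> Delta A B \<in> doubled r k"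
  by (auto simp: doubled_def)

lemma doubledE:
  assumes "X \<in> doubled r k"
  obtains A B where "X = Delta A B" "A \<in> carrier_mat r k" "B \<in> carrier_mat r k"
  using assms by (auto simp: doubled_def)

lemma doubled_dim: "X \<in> doubled r k \<Longrightarrow> dim_row X = 2 * r" "X \<in> doubled r k \<Longrightarrow> dim_col X = 2 * k"
  by (auto simp: doubled_def)

lemma split_block_four_block_mat:
  assumes "A \<in> carrier_mat r k" "B \<in> carrier_mat r l" "C \<in> carrier_mat q k" "D \<in> carrier_mat q l"
  shows "split_block (four_block_mat A B C D) r k = (A, B, C, D)"
  using assms by (auto simp: split_block_def Let_def)

text \<open>Once the block sizes are fixed, \<open>split_block\<close> recovers the four
  blocks.\<close>

lemma four_block_mat_inject:
  assumes "four_block_mat A B C D = four_block_mat A' B' C' D'"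
    "A \<in> carrier_mat r k" "B \<in> carrier_mat r l" "C \<in> carrier_mat q k" "D \<in> carrier_mat q l"
    "A' \<in> carrier_mat r k" "B' \<in> carrier_mat r l" "C' \<in> carrier_mat q k" "D' \<in> carrier_mat q l"
  shows "A = A'" "B = B'" "C = C'" "D = D'"
proof -
  show "A = A'" "B = B'" "C = C'" "D = D'"
    using split_block_four_block_mat[OF assms(2-5)] split_block_four_block_mat[OF assms(6-9)] unfolding assms(1) by simp_all
qed

lemma Delta_inject:
  assumes "Delta A B = Delta A' B'" "A \<in> carrier_mat r k" "B \<in> carrier_mat r k"
    "A' \<in> carrier_mat r k" "B' \<in> carrier_mat r k"
  shows "A = A'" "B = B'"
  by (rule four_block_mat_inject(1,2)[OF assms(1)[unfolded Delta_def], of r k k r];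
      simp only: conj_mat_carrier assms(2-5))+

lemma Delta_mult:
  assumes "A \<in> carrier_mat r k" "B \<in> carrier_mat r k" "C \<in> carrier_mat k l" "D \<in> carrier_mat k l"
  shows "Delta A B * Delta C D = Delta (A * C + B * conj_mat D) (A * D + B * conj_mat C)"
proof -
  \<comment> \<open>The lower block row of the product is the conjugate of the upper one, up to the
    order of the summands.\<close>
  have "conj_mat (A * C + B * conj_mat D) = conj_mat B * D + conj_mat A * conj_mat C"
    "conj_mat (A * D + B * conj_mat C) = conj_mat B * C + conj_mat A * conj_mat D"
    using assms
    by (simp_all add: conj_mat_add[of _ r l] conj_mat_mult[of _ r k _ l] comm_add_mat[of _ r l])
  then show ?thesis
    unfolding Delta_def using assms
    by (simp add: mult_four_block_mat[of _ r k _ k _ r _ _ l _ l])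
qed

lemma doubled_mult:
  assumes "X \<in> doubled r k" "Y \<in> doubled k l"
  shows "X * Y \<in> doubled r l"
  using assms
proof (elim doubledE)
  fix A B C D
  assume *: "A \<in> carrier_mat r k" "B \<in> carrier_mat r k" "C \<in> carrier_mat k l" "D \<in> carrier_mat k l"
    "X = Delta A B" "Y = Delta C D"
  show ?thesis
    unfolding *(5,6) Delta_mult[OF *(1-4)] by (rule Delta_in_doubled) (use *(1-4) in auto)
qed

lemma doubled_add:
  assumes "X \<in> doubled r k" "Y \<in> doubled r k"
  shows "X + Y \<in> doubled r k"
  using assms
proof (elim doubledE)
  fix A B C D
  assume *: "A \<in> carrier_mat r k" "B \<in> carrier_mat r k" "C \<in> carrier_mat r k" "D \<in> carrier_mat r k"
    "X = Delta A B" "Y = Delta C D"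
  then have "X + Y = Delta (A + C) (B + D)"
    unfolding Delta_def by (simp add: conj_mat_add add_four_block_mat[of _ r k _ k _ r])
  with * show ?thesis by (auto intro: Delta_in_doubled)
qed

lemma doubled_smult:
  assumes "X \<in> doubled r k" "c \<in> \<real>"
  shows "c \<cdot>\<^sub>m X \<in> doubled r k"
proof -
  obtain A B where *: "A \<in> carrier_mat r k" "B \<in> carrier_mat r k" "X = Delta A B"
    using assms(1) by (rule doubledE)
  have "conj_mat (c \<cdot>\<^sub>m Y) = c \<cdot>\<^sub>m conj_mat Y" for Y
    using assms(2) by (auto simp: conj_mat_def Reals_cnj_iff)
  with * have "c \<cdot>\<^sub>m X = Delta (c \<cdot>\<^sub>m A) (c \<cdot>\<^sub>m B)"
    unfolding Delta_def by (simp add: smult_four_block_mat[of _ r k _ k _ r])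
  with * show ?thesis by (auto intro: Delta_in_doubled)
qed

lemma doubled_uminus: "X \<in> doubled r k \<Longrightarrow> - X \<in> doubled r k"
  unfolding uminus_eq_smult_mat by (rule doubled_smult) auto

lemma doubled_minus:
  assumes "X \<in> doubled r k" "Y \<in> doubled r k"
  shows "X - Y \<in> doubled r k"
proof -
  have "X - Y = X + - Y" using assms by (auto dest!: doubled_dim)
  then show ?thesis using assms by (simp add: doubled_add doubled_uminus)
qed

text \<open>The signs of the two J factors cancel on the diagonal blocks and leave one minus on the
  off-diagonal blocks.\<close>

lemma flat_Delta:
  assumes A: "A \<in> carrier_mat r k" and B: "B \<in> carrier_mat r k"
  shows "flat (Delta A B) = Delta (mat_adjoint A) (- transpose_mat B)"
proof -
  have *: "mat_adjoint (Delta A B)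
      = four_block_mat (mat_adjoint A) (transpose_mat B) (mat_adjoint B) (transpose_mat A)"
    using A B by (intro eq_matI) (auto simp: Delta_def mat_adjoint_eq conj_mat_def)
  have "flat (Delta A B) = four_block_mat (mat_adjoint A) (- transpose_mat B) (- mat_adjoint B) (transpose_mat A)"
    using A B unfolding flat_def *
    apply (simp add: J_mat_def)
    apply (subst mult_four_block_mat[of _ k k _ k _ k _ _ r _ r]; (simp add: mat_adjoint_eq)?)
    apply (subst mult_four_block_mat[of _ k r _ r _ k _ _ r _ r]; (simp add: mat_adjoint_eq)?)
    done
  also have "\<dots> = Delta (mat_adjoint A) (- transpose_mat B)"
    unfolding Delta_def by (intro cong_four_block_mat) (auto simp: conj_mat_def mat_adjoint_eq)
  finally show ?thesis .
qed

lemma doubled_flat: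
  assumes "X \<in> doubled r k"
  shows "flat X \<in> doubled k r"
  using assms
proof (elim doubledE)
  fix A B
  assume *: "A \<in> carrier_mat r k" "B \<in> carrier_mat r k" "X = Delta A B"
  show ?thesis
    unfolding *(3) flat_Delta[OF *(1,2)]
    by (rule Delta_in_doubled) (use *(1,2) in \<open>auto simp: mat_adjoint_eq\<close>)
qed

lemma one_eq_Delta: "1\<^sub>m (2 * n) = Delta (1\<^sub>m n) (0\<^sub>m n n)"
  by (simp add: Delta_def mult_2)

lemma one_in_doubled: "1\<^sub>m (2 * n) \<in> doubled n n"
  by (auto simp: one_eq_Delta intro: Delta_in_doubled)

lemma zero_in_doubled: "0\<^sub>m (2 * r) (2 * k) \<in> doubled r k"
proof -
  have "Delta (0\<^sub>m r k) (0\<^sub>m r k) = 0\<^sub>m (2 * r) (2 * k)"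
    by (simp add: Delta_def mult_2)
  then show ?thesis by (metis Delta_in_doubled zero_carrier_mat)
qed

section \<open>The group Sp of doubled-up matrices inverted by \<open>flat\<close>\<close>

lemma Sp_eq: "Sp n = {S \<in> doubled n n. flat S * S = 1\<^sub>m (2 * n) \<and> S * flat S = 1\<^sub>m (2 * n)}"
  by (auto simp: Sp_def doubled_def)

lemma Sp_D:
  assumes "S \<in> Sp n"
  shows "S \<in> doubled n n" "dim_row S = 2 * n" "dim_col S = 2 * n"
    "flat S * S = 1\<^sub>m (2 * n)" "S * flat S = 1\<^sub>m (2 * n)"
  using assms by (auto simp: Sp_eq doubled_dim)

lemma Sp_one: "1\<^sub>m (2 * n) \<in> Sp n"
  by (simp add: Sp_eq one_in_doubled)

lemma Sp_flat:
  assumes "S \<in> Sp n"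
  shows "flat S \<in> Sp n"
  using Sp_D[OF assms] by (simp add: Sp_eq doubled_flat flat_flat)

lemma Sp_mult:
  assumes "S \<in> Sp n" "T \<in> Sp n"
  shows "S * T \<in> Sp n"
proof -
  note S = Sp_D[OF assms(1)] and T = Sp_D[OF assms(2)]
  have "flat (S * T) * (S * T) = flat T * (flat S * (S * T))"
    using S T by (simp add: flat_mult assoc_mult_mat_dim)
  also have "\<dots> = 1\<^sub>m (2 * n)"
    using S T by (simp add: mult_mat_cancel_left[OF S(4)])
  finally have 1: "flat (S * T) * (S * T) = 1\<^sub>m (2 * n)" .
  have "S * T * flat (S * T) = S * (T * (flat T * flat S))"
    using S T by (simp add: flat_mult assoc_mult_mat_dim)
  also have "\<dots> = 1\<^sub>m (2 * n)"
    using S T by (simp add: mult_mat_cancel_left[OF T(5)])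
  finally show ?thesis
    using 1 doubled_mult[OF S(1) T(1)] by (simp add: Sp_eq)
qed

section \<open>The imaginary part with respect to \<open>flat\<close>\<close>

lemma Im_flat_dim [simp]:
  "dim_row (Im_flat X) = 2 * (dim_col X div 2)" "dim_col (Im_flat X) = 2 * (dim_row X div 2)"
  by (simp_all add: Im_flat_def)

lemma Im_flat_add:
  assumes "X \<in> carrier_mat (2 * m) (2 * m)" "Y \<in> carrier_mat (2 * m) (2 * m)"
  shows "Im_flat (X + Y) = Im_flat X + Im_flat Y"
  using assms by (intro eq_matI) (auto simp: Im_flat_def flat_add algebra_simps add_divide_distrib)

lemma Im_flat_eq_zero:
  assumes "X \<in> carrier_mat (2 * m) (2 * m)" "flat X = X"
  shows "Im_flat X = 0\<^sub>m (2 * m) (2 * m)"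
  using assms by (intro eq_matI) (auto simp: Im_flat_def)

lemma Im_flat_congruence:
  assumes "dim_row X = 2 * m" "dim_col X = 2 * m" "dim_row E = 2 * m" "dim_col E = 2 * k"
  shows "Im_flat (flat E * (X * E)) = flat E * (Im_flat X * E)"
proof -
  have "flat (flat E * (X * E)) = flat E * (flat X * E)"
    using assms by (simp add: flat_mult flat_flat assoc_mult_mat_dim)
  then show ?thesis
    using assms by (simp add: Im_flat_def mat_dim_simps)
qed

lemma flat_Im_flat:
  assumes "dim_row X = 2 * m" "dim_col X = 2 * m"
  shows "flat (Im_flat X) = Im_flat X"
proof -
  \<comment> \<open>Conjugation negates 1/(2i), and \<open>flat\<close> exchanges the two terms of
    the difference; the two signs cancel.\<close>
  have "flat (Im_flat X) = cnj (1 / (2 * \<i>)) \<cdot>\<^sub>m (flat X - X)"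
    using assms by (simp add: Im_flat_def flat_smult flat_minus flat_flat)
  also have "\<dots> = Im_flat X"
    using assms by (intro eq_matI) (auto simp: Im_flat_def algebra_simps)
  finally show ?thesis .
qed

text \<open>The factor i turns 1/(2i) into the real number 1/2, under which doubled-up form is
  preserved.\<close>

lemma doubled_i_Im_flat:
  assumes "X \<in> doubled m m"
  shows "\<i> \<cdot>\<^sub>m Im_flat X \<in> doubled m m"
proof -
  have "\<i> \<cdot>\<^sub>m Im_flat X = (1 / 2) \<cdot>\<^sub>m (X - flat X)"
    using doubled_dim[OF assms] by (intro eq_matI) (auto simp: Im_flat_def field_simps)
  then show ?thesis
    using assms by (auto intro!: doubled_smult doubled_minus doubled_flat)
qed

section \<open>Embeddings of mode lists\<close>

text \<open>An incidence matrix of names. It makes sense for any two lists, so one definition serves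
  for embedding modes, for restricting to them and for reordering them.\<close>

definition mode_sel :: "'l list \<Rightarrow> 'l list \<Rightarrow> complex mat" where
  "mode_sel ms ms' = mat (length ms) (length ms') (\<lambda>(k, j). if ms ! k = ms' ! j then 1 else 0)"

text \<open>This is E: the same selection acts on both halves of the doubled-up space. Used as
  \<open>mode_emb (modes G) ms\<close> it extends \<open>G\<close> to \<open>ms\<close>; exchanging
  the lists gives E^flat.\<close>

definition mode_emb :: "'l list \<Rightarrow> 'l list \<Rightarrow> complex mat" where
  "mode_emb ms ms' = Delta (mode_sel ms ms') (0\<^sub>m (length ms) (length ms'))"

lemma mode_sel_dim [simp]:
  "dim_row (mode_sel ms ms') = length ms" "dim_col (mode_sel ms ms') = length ms'"
  by (auto simp: mode_sel_def)

lemma mode_sel_carrier: "mode_sel ms ms' \<in> carrier_mat (length ms) (length ms')"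
  by (simp add: mode_sel_def)

lemma conj_mode_sel [simp]: "conj_mat (mode_sel ms ms') = mode_sel ms ms'"
  by (rule eq_matI) (auto simp: mode_sel_def conj_mat_def)

lemma transpose_mode_sel: "transpose_mat (mode_sel ms ms') = mode_sel ms' ms"
  by (rule eq_matI) (auto simp: mode_sel_def)

lemma mode_sel_self: "distinct ms \<Longrightarrow> mode_sel ms ms = 1\<^sub>m (length ms)"
  by (rule eq_matI) (auto simp: mode_sel_def nth_eq_iff_index_eq)

lemma nth_eq_iff_pos:
  assumes "distinct ms" "l \<in> set ms" "k < length ms"
  shows "ms ! k = l \<longleftrightarrow> k = pos ms l"
proof -
  obtain p where p: "p < length ms" "ms ! p = l"
    using assms(2) by (auto simp: in_set_conv_nth)
  have "pos ms l = p"
    unfolding pos_def by (rule the_equality) (use p assms(1) in \<open>auto simp: nth_eq_iff_index_eq\<close>)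
  then show ?thesis
    using p assms(1,3) by (auto simp: nth_eq_iff_index_eq)
qed

lemma pos_less:
  assumes "distinct ms" "l \<in> set ms"
  shows "pos ms l < length ms"
  using assms nth_eq_iff_pos[OF assms] by (metis in_set_conv_nth)

text \<open>At most one summand survives because names do not repeat. This links the lookup by
  \<open>pos\<close> in the padding functions with multiplication by a 0/1 matrix.\<close>

lemma sum_pos:
  fixes f :: "nat \<Rightarrow> complex"
  assumes "distinct ms"
  shows "(\<Sum>k<length ms. if ms ! k = l then f k else 0) = (if l \<in> set ms then f (pos ms l) else 0)"
proof (cases "l \<in> set ms")
  case True
  have "(\<Sum>k<length ms. if ms ! k = l then f k else 0)
      = (\<Sum>k<length ms. if k = pos ms l then f k else 0)"
    by (rule sum.cong) (simp_all add: nth_eq_iff_pos[OF assms True])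
  with True show ?thesis by (simp add: pos_less[OF assms])
next
  case False
  then have "(\<Sum>k<length ms. if ms ! k = l then f k else 0) = (\<Sum>k<length ms. 0)"
    by (intro sum.cong) auto
  with False show ?thesis by simp
qed

lemma pad_cols_eq:
  assumes "distinct ms" "dim_col X = length ms"
  shows "pad_cols ms ms' X = X * mode_sel ms ms'"
proof (rule eq_matI)
  fix i j assume *: "i < dim_row (X * mode_sel ms ms')" "j < dim_col (X * mode_sel ms ms')"
  then have "(X * mode_sel ms ms') $$ (i, j)
      = (\<Sum>k<length ms. if ms ! k = ms' ! j then X $$ (i, k) else 0)"
    using assms(2) by (auto simp: scalar_prod_def mode_sel_def atLeast0LessThan intro!: sum.cong)
  then show "pad_cols ms ms' X $$ (i, j) = (X * mode_sel ms ms') $$ (i, j)"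
    using * unfolding sum_pos[OF assms(1)] by (simp add: pad_cols_def)
qed (simp_all add: pad_cols_def)

lemma pad_rows_eq:
  assumes "distinct ms" "dim_row X = length ms"
  shows "pad_rows ms ms' X = mode_sel ms' ms * X"
proof (rule eq_matI)
  fix i j assume *: "i < dim_row (mode_sel ms' ms * X)" "j < dim_col (mode_sel ms' ms * X)"
  then have "(mode_sel ms' ms * X) $$ (i, j)
      = (\<Sum>k<length ms. if ms ! k = ms' ! i then X $$ (k, j) else 0)"
    using assms(2) by (auto simp: scalar_prod_def mode_sel_def atLeast0LessThan intro!: sum.cong)
  then show "pad_rows ms ms' X $$ (i, j) = (mode_sel ms' ms * X) $$ (i, j)"
    using * unfolding sum_pos[OF assms(1)] by (simp add: pad_rows_def)
qed (simp_all add: pad_rows_def)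

text \<open>Passing through \<open>ms'\<close> loses only those names shared by \<open>ms\<close>
  and \<open>ms''\<close> that \<open>ms'\<close> lacks; if \<open>ms'\<close> contains one of the
  outer lists there are none.\<close>

lemma mode_sel_mult:
  assumes "distinct ms'" "set ms \<subseteq> set ms' \<or> set ms'' \<subseteq> set ms'"
  shows "mode_sel ms ms' * mode_sel ms' ms'' = mode_sel ms ms''"
proof (rule eq_matI)
  fix i j assume *: "i < dim_row (mode_sel ms ms'')" "j < dim_col (mode_sel ms ms'')"
  then have "(mode_sel ms ms' * mode_sel ms' ms'') $$ (i, j)
      = (\<Sum>k<length ms'. if ms' ! k = ms'' ! j then (if ms ! i = ms' ! k then 1 else 0) else 0)"
    by (auto simp: scalar_prod_def mode_sel_def atLeast0LessThan intro!: sum.cong)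
  also have "\<dots> = (if ms'' ! j \<in> set ms' \<and> ms ! i = ms' ! pos ms' (ms'' ! j) then 1 else 0)"
    unfolding sum_pos[OF assms(1)] by simp
  also have "ms'' ! j \<in> set ms' \<and> ms ! i = ms' ! pos ms' (ms'' ! j) \<longleftrightarrow> ms ! i = ms'' ! j"
  proof -
    have "ms' ! pos ms' (ms'' ! j) = ms'' ! j" if "ms'' ! j \<in> set ms'"
      using nth_eq_iff_pos[OF assms(1) that pos_less[OF assms(1) that]] by simp
    moreover have "ms'' ! j \<in> set ms'" if "ms ! i = ms'' ! j"
      using assms(2) * that nth_mem[of i ms] nth_mem[of j ms''] by auto
    ultimately show ?thesis by auto
  qed
  also have "(if ms ! i = ms'' ! j then 1 else 0) = mode_sel ms ms'' $$ (i, j)"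
    using * by (simp add: mode_sel_def)
  finally show "(mode_sel ms ms' * mode_sel ms' ms'') $$ (i, j) = mode_sel ms ms'' $$ (i, j)" .
qed simp_all

lemma mode_emb_dim [simp]:
  "dim_row (mode_emb ms ms') = 2 * length ms" "dim_col (mode_emb ms ms') = 2 * length ms'"
  by (auto simp: mode_emb_def)

lemma mode_emb_doubled: "mode_emb ms ms' \<in> doubled (length ms) (length ms')"
  unfolding mode_emb_def by (intro Delta_in_doubled mode_sel_carrier zero_carrier_mat)

lemma mode_emb_eq:
  "mode_emb ms ms' = four_block_mat (mode_sel ms ms') (0\<^sub>m (length ms) (length ms'))
     (0\<^sub>m (length ms) (length ms')) (mode_sel ms ms')"
  by (simp add: mode_emb_def Delta_def)

lemma mode_emb_self: "distinct ms \<Longrightarrow> mode_emb ms ms = 1\<^sub>m (2 * length ms)"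
  by (simp add: mode_emb_def mode_sel_self one_eq_Delta)

text \<open>The entries are real and the off-diagonal blocks vanish, so \<open>flat\<close> is mere
  transposition here.\<close>

lemma flat_mode_emb: "flat (mode_emb ms ms') = mode_emb ms' ms"
proof -
  have "mat_adjoint (mode_sel ms ms') = conj_mat (mode_sel ms' ms)"
    by (simp add: mat_adjoint_eq transpose_mode_sel conj_mat_def)
  moreover have "- 0\<^sub>m k l = (0\<^sub>m k l :: complex mat)" for k l
    by auto
  ultimately show ?thesis
    unfolding mode_emb_def by (simp add: flat_Delta[OF mode_sel_carrier])
qed

lemma mode_emb_mult:
  assumes "distinct ms'" "set ms \<subseteq> set ms' \<or> set ms'' \<subseteq> set ms'"
  shows "mode_emb ms ms' * mode_emb ms' ms'' = mode_emb ms ms''"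
  unfolding mode_emb_def
  by (subst Delta_mult[OF mode_sel_carrier zero_carrier_mat mode_sel_carrier zero_carrier_mat])
    (simp add: mode_sel_mult[OF assms] left_mult_zero_mat[OF mode_sel_carrier]
      right_mult_zero_mat[OF mode_sel_carrier] right_add_zero_mat[OF mode_sel_carrier])

lemma map_blocks_four_block:
  assumes "A \<in> carrier_mat r k" "B \<in> carrier_mat r l" "C \<in> carrier_mat q k" "D \<in> carrier_mat q l"
  shows "map_blocks r k f (four_block_mat A B C D) = four_block_mat (f A) (f B) (f C) (f D)"
  by (simp add: map_blocks_def split_block_four_block_mat[OF assms])

text \<open>\<open>mode_emb\<close> is block diagonal with two equal blocks, so multiplying by it
  treats the four blocks of X separately, as \<open>map_blocks\<close> does.\<close>

lemma map_blocks_cols: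
  assumes "distinct ms" "dim_row X = 2 * r" "dim_col X = 2 * length ms"
  shows "map_blocks r (length ms) (pad_cols ms ms') X = X * mode_emb ms ms'"
proof -
  let ?m = "length ms"
  obtain A B C D where spl: "split_block X r ?m = (A, B, C, D)"
    by (metis prod_cases4)
  note s = split_block[OF spl assms(2,3)[unfolded mult_2]]
  show ?thesis
    unfolding s(5) mode_emb_eq map_blocks_four_block[OF s(1-4)]
      mult_four_block_mat[OF s(1-4) mode_sel_carrier zero_carrier_mat zero_carrier_mat mode_sel_carrier]
    using s(1-4)
    by (simp add: pad_cols_eq[OF assms(1)] add_zero_mat_dim)
qed

lemma map_blocks_rows_cols:
  assumes "distinct ms" "dim_row X = 2 * length ms" "dim_col X = 2 * length ms"
  shows "map_blocks (length ms) (length ms) (\<lambda>X. pad_rows ms ms' (pad_cols ms ms' X)) X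
      = mode_emb ms' ms * (X * mode_emb ms ms')"
proof -
  let ?m = "length ms"
  obtain A B C D where spl: "split_block X ?m ?m = (A, B, C, D)"
    by (metis prod_cases4)
  note s = split_block[OF spl assms(2,3)[unfolded mult_2]]
  note t = s(1-4)[THEN mult_carrier_mat, OF mode_sel_carrier]
  have "X * mode_emb ms ms' = four_block_mat (A * mode_sel ms ms') (B * mode_sel ms ms')
      (C * mode_sel ms ms') (D * mode_sel ms ms')"
    unfolding s(5) mode_emb_eq
      mult_four_block_mat[OF s(1-4) mode_sel_carrier zero_carrier_mat zero_carrier_mat mode_sel_carrier]
    using s(1-4) by (simp add: add_zero_mat_dim)
  then have "mode_emb ms' ms * (X * mode_emb ms ms')
      = four_block_mat (mode_sel ms' ms * (A * mode_sel ms ms')) (mode_sel ms' ms * (B * mode_sel ms ms'))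
        (mode_sel ms' ms * (C * mode_sel ms ms')) (mode_sel ms' ms * (D * mode_sel ms ms'))"
    unfolding mode_emb_eq
    using mult_four_block_mat[OF mode_sel_carrier zero_carrier_mat zero_carrier_mat mode_sel_carrier t]
      s(1-4)
    by (simp add: add_zero_mat_dim mult_zero_mat_dim)
  then show ?thesis
    unfolding s(5) map_blocks_four_block[OF s(1-4)]
    using s(1-4) by (simp add: pad_cols_eq[OF assms(1)] pad_rows_eq[OF assms(1)])
qed

section \<open>Systems\<close>

text \<open>Write i H as Delta P Q. Then H = H^flat means (i H)^flat = - i H, which by
  \<open>flat_Delta\<close> says that P is anti-Hermitian and Q symmetric; dividing by i gives a
  Hermitian and a symmetric block.\<close>

lemma ham_doubled_iff:
  assumes H: "\<i> \<cdot>\<^sub>m H \<in> doubled m m"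
  shows "flat H = H \<longleftrightarrow> (\<exists>Om\<in>carrier_mat m m. \<exists>Op\<in>carrier_mat m m.
    mat_adjoint Om = Om \<and> transpose_mat Op = Op \<and> \<i> \<cdot>\<^sub>m H = Delta (\<i> \<cdot>\<^sub>m Om) (\<i> \<cdot>\<^sub>m Op))"
proof -
  have dim: "dim_row H = 2 * m" "dim_col H = 2 * m"
    using doubled_dim[OF H] by simp_all
  have Hi: "H = (- \<i>) \<cdot>\<^sub>m (\<i> \<cdot>\<^sub>m H)"
    by (rule eq_matI) auto
  have uminus_Delta: "- Delta A B = Delta (- A) (- B)" if "A \<in> carrier_mat m m" "B \<in> carrier_mat m m" for A B
    using that by (intro eq_matI) (auto simp: Delta_def conj_mat_def)
  have fH: "flat H = \<i> \<cdot>\<^sub>m flat (\<i> \<cdot>\<^sub>m H)"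
    using dim by (subst Hi) (simp add: flat_smult)
  show ?thesis
  proof
    assume flat: "flat H = H"
    obtain P Q where PQ: "P \<in> carrier_mat m m" "Q \<in> carrier_mat m m" "\<i> \<cdot>\<^sub>m H = Delta P Q"
      using H by (auto elim: doubledE)
    have "flat (\<i> \<cdot>\<^sub>m H) = - (\<i> \<cdot>\<^sub>m H)"
      using dim by (subst flat_smult) (auto simp: flat intro!: eq_matI)
    then have "Delta (mat_adjoint P) (- transpose_mat Q) = Delta (- P) (- Q)"
      unfolding PQ(3) flat_Delta[OF PQ(1,2)] uminus_Delta[OF PQ(1,2)] .
    from Delta_inject[OF this, of m m] PQ
    have adj: "mat_adjoint P = - P" "transpose_mat Q = Q"
      by (auto simp: mat_adjoint_eq)
    \<comment> \<open>Dividing by i turns the anti-Hermitian P into a Hermitian matrix and keeps Q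
      symmetric.\<close>
    let ?Om = "(- \<i>) \<cdot>\<^sub>m P" and ?Op = "(- \<i>) \<cdot>\<^sub>m Q"
    have "mat_adjoint ?Om = \<i> \<cdot>\<^sub>m mat_adjoint P"
      by (auto simp: mat_adjoint_eq)
    then have "mat_adjoint ?Om = ?Om"
      by (auto simp: adj)
    moreover have "transpose_mat ?Op = (- \<i>) \<cdot>\<^sub>m transpose_mat Q"
      by auto
    then have "transpose_mat ?Op = ?Op"
      by (simp only: adj)
    moreover have "\<i> \<cdot>\<^sub>m ?Om = P" "\<i> \<cdot>\<^sub>m ?Op = Q"
      by auto
    ultimately show "\<exists>Om\<in>carrier_mat m m. \<exists>Op\<in>carrier_mat m m.
        mat_adjoint Om = Om \<and> transpose_mat Op = Op \<and> \<i> \<cdot>\<^sub>m H = Delta (\<i> \<cdot>\<^sub>m Om) (\<i> \<cdot>\<^sub>m Op)"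
      using PQ by (intro bexI[of _ ?Om] bexI[of _ ?Op]) auto
  next
    assume "\<exists>Om\<in>carrier_mat m m. \<exists>Op\<in>carrier_mat m m.
        mat_adjoint Om = Om \<and> transpose_mat Op = Op \<and> \<i> \<cdot>\<^sub>m H = Delta (\<i> \<cdot>\<^sub>m Om) (\<i> \<cdot>\<^sub>m Op)"
    then obtain Om Op where *: "Om \<in> carrier_mat m m" "Op \<in> carrier_mat m m"
      "mat_adjoint Om = Om" "transpose_mat Op = Op" "\<i> \<cdot>\<^sub>m H = Delta (\<i> \<cdot>\<^sub>m Om) (\<i> \<cdot>\<^sub>m Op)"
      by blast
    have "mat_adjoint (\<i> \<cdot>\<^sub>m Om) = (- \<i>) \<cdot>\<^sub>m mat_adjoint Om"
      by (auto simp: mat_adjoint_eq)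
    also have "\<dots> = - (\<i> \<cdot>\<^sub>m Om)"
      unfolding *(3) by auto
    finally have "mat_adjoint (\<i> \<cdot>\<^sub>m Om) = - (\<i> \<cdot>\<^sub>m Om)" .
    moreover have "transpose_mat (\<i> \<cdot>\<^sub>m Op) = \<i> \<cdot>\<^sub>m transpose_mat Op"
      by auto
    ultimately have "flat (\<i> \<cdot>\<^sub>m H) = - (\<i> \<cdot>\<^sub>m H)"
      using *(1,2) by (simp add: *(4,5) flat_Delta[of _ m m] uminus_Delta)
    then show "flat H = H"
      using fH by (auto intro!: eq_matI)
  qed
qed

text \<open>The working form of membership: couplings and Hamiltonians are now handled by closure
  rules for \<open>doubled\<close> and \<open>flat\<close>, without exhibiting blocks. The minus
  signs on the two sides of the condition in \<open>Bog_nm\<close> cancel, which leaves the factor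
  i.\<close>

lemma Bog_iff:
  "G \<in> Bog n \<longleftrightarrow> distinct (modes G) \<and> scat G \<in> Sp n \<and> coup G \<in> doubled n (length (modes G))
    \<and> \<i> \<cdot>\<^sub>m ham G \<in> doubled (length (modes G)) (length (modes G)) \<and> flat (ham G) = ham G"
proof -
  let ?m = "length (modes G)"
  have neg: "(- \<i>) \<cdot>\<^sub>m H = - D \<longleftrightarrow> \<i> \<cdot>\<^sub>m H = D" for H D
  proof -
    have "(- \<i>) \<cdot>\<^sub>m H = - (\<i> \<cdot>\<^sub>m H)"
      by auto
    then show ?thesis
      by (metis uminus_uminus_mat)
  qed
  have "(\<exists>Om\<in>carrier_mat ?m ?m. \<exists>Op\<in>carrier_mat ?m ?m.
      mat_adjoint Om = Om \<and> transpose_mat Op = Op \<and> \<i> \<cdot>\<^sub>m ham G = Delta (\<i> \<cdot>\<^sub>m Om) (\<i> \<cdot>\<^sub>m Op))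
    \<longleftrightarrow> \<i> \<cdot>\<^sub>m ham G \<in> doubled ?m ?m \<and> flat (ham G) = ham G" (is "?L \<longleftrightarrow> ?R")
  proof
    assume L: ?L
    then have "\<i> \<cdot>\<^sub>m ham G \<in> doubled ?m ?m"
      by (auto intro!: Delta_in_doubled)
    with L show ?R
      using ham_doubled_iff by blast
  next
    assume ?R
    then show ?L
      using ham_doubled_iff by blast
  qed
  then show ?thesis
    unfolding Bog_def Bog_nm_def neg doubled_def by auto
qed

lemma Bog_D:
  assumes "G \<in> Bog n"
  shows "distinct (modes G)" "scat G \<in> Sp n" "coup G \<in> doubled n (length (modes G))"
    "\<i> \<cdot>\<^sub>m ham G \<in> doubled (length (modes G)) (length (modes G))" "flat (ham G) = ham G"
  using assms by (auto simp: Bog_iff)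

lemma Bog_dim:
  assumes "G \<in> Bog n"
  shows "dim_row (scat G) = 2 * n" "dim_col (scat G) = 2 * n"
    "dim_row (coup G) = 2 * n" "dim_col (coup G) = 2 * length (modes G)"
    "dim_row (ham G) = 2 * length (modes G)" "dim_col (ham G) = 2 * length (modes G)"
  using Bog_D[OF assms] Sp_D(2,3)[of "scat G" n] doubled_dim[OF Bog_D(3)[OF assms]]
    doubled_dim[OF Bog_D(4)[OF assms]] by auto

section \<open>Extension by zeros as a congruence\<close>

lemma zero_ext_eq:
  assumes "G \<in> Bog n"
  shows "zero_ext ms G = LSys ms (scat G) (coup G * mode_emb (modes G) ms)
    (mode_emb ms (modes G) * (ham G * mode_emb (modes G) ms))"
  using Bog_D(1)[OF assms] Bog_dim[OF assms]
  by (simp add: zero_ext_def Let_def map_blocks_cols map_blocks_rows_cols)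

lemma modes_zero_ext [simp]: "modes (zero_ext ms G) = ms"
  and scat_zero_ext [simp]: "scat (zero_ext ms G) = scat G"
  by (simp_all add: zero_ext_def Let_def)

lemma zero_ext_Bog:
  assumes "G \<in> Bog n" "distinct ms"
  shows "zero_ext ms G \<in> Bog n"
proof -
  let ?E = "mode_emb (modes G) ms" and ?E' = "mode_emb ms (modes G)"
  note D = Bog_D[OF assms(1)] and dim = Bog_dim[OF assms(1)]
  have "\<i> \<cdot>\<^sub>m (?E' * (ham G * ?E)) = ?E' * (\<i> \<cdot>\<^sub>m ham G * ?E)"
    using dim by (simp add: mat_dim_simps)
  then have "\<i> \<cdot>\<^sub>m (?E' * (ham G * ?E)) \<in> doubled (length ms) (length ms)"
    using doubled_mult[OF mode_emb_doubled doubled_mult[OF D(4) mode_emb_doubled]] by simp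
  moreover have "flat (?E' * (ham G * ?E)) = ?E' * (ham G * ?E)"
    using dim by (simp add: flat_mult D(5) flat_mode_emb assoc_mult_mat_dim)
  ultimately show ?thesis
    using assms(2) D(2) doubled_mult[OF D(3) mode_emb_doubled]
    by (simp add: Bog_iff zero_ext_eq[OF assms(1)])
qed

lemma zero_ext_self:
  assumes "G \<in> Bog n"
  shows "zero_ext (modes G) G = G"
  using Bog_D(1)[OF assms] Bog_dim[OF assms]
  by (simp add: zero_ext_eq[OF assms] mode_emb_self mult_one_mat_dim)

text \<open>\<open>ms\<close> contains the modes of \<open>G\<close>, so the detour through it loses
  nothing. The target \<open>ms'\<close> is arbitrary, which later makes equality of extensions
  independent of the list on which it was first observed.\<close>

lemma zero_ext_zero_ext:
  assumes "G \<in> Bog n" "distinct ms" "set (modes G) \<subseteq> set ms"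
  shows "zero_ext ms' (zero_ext ms G) = zero_ext ms' G"
proof -
  note dim = Bog_dim[OF assms(1)]
  have 1: "mode_emb (modes G) ms * mode_emb ms ms' = mode_emb (modes G) ms'"
    and 2: "mode_emb ms' ms * mode_emb ms (modes G) = mode_emb ms' (modes G)"
    using assms by (simp_all add: mode_emb_mult)
  have "mode_emb ms' ms * (mode_emb ms (modes G) * (ham G * mode_emb (modes G) ms) * mode_emb ms ms')
      = (mode_emb ms' ms * mode_emb ms (modes G)) * (ham G * (mode_emb (modes G) ms * mode_emb ms ms'))"
    using dim by (simp only: assoc_mult_mat_dim mode_emb_dim index_mult_mat)
  then show ?thesis
    unfolding zero_ext_eq[OF zero_ext_Bog[OF assms(1,2)]] modes_zero_ext scat_zero_ext
    unfolding zero_ext_eq[OF assms(1)]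
    using dim by (simp add: assoc_mult_mat_dim 1 2)
qed

section \<open>The series product on a common list of modes\<close>

lemma series_Bog:
  assumes "G2 \<in> Bog n" "G1 \<in> Bog n" "modes G2 = modes G1"
  shows "G2 \<triangleleft> G1 \<in> Bog n"
proof -
  note D1 = Bog_D[OF assms(1)] and dim1 = Bog_dim[OF assms(1)]
  note D2 = Bog_D[OF assms(2)] and dim2 = Bog_dim[OF assms(2)]
  let ?m = "length (modes G1)"
  let ?X = "flat (coup G2) * scat G2 * coup G1"
  have X: "?X \<in> doubled ?m ?m"
    using doubled_mult[OF doubled_mult[OF doubled_flat[OF D1(3)] Sp_D(1)[OF D1(2)]] D2(3)]
    by (simp add: assms(3))
  have "\<i> \<cdot>\<^sub>m (ham G1 + ham G2 + Im_flat ?X) = \<i> \<cdot>\<^sub>m ham G1 + \<i> \<cdot>\<^sub>m ham G2 + \<i> \<cdot>\<^sub>m Im_flat ?X"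
    using dim1 dim2 assms(3) by (intro eq_matI) (simp_all add: algebra_simps)
  then have "\<i> \<cdot>\<^sub>m (ham G1 + ham G2 + Im_flat ?X) \<in> doubled ?m ?m"
    using D1(4) D2(4) doubled_i_Im_flat[OF X] assms(3) by (simp add: doubled_add)
  moreover have "flat (ham G1 + ham G2 + Im_flat ?X) = ham G1 + ham G2 + Im_flat ?X"
    using dim1 dim2 assms(3) flat_Im_flat[of ?X ?m] by (simp add: flat_add D1(5) D2(5))
  moreover have "coup G2 + scat G2 * coup G1 \<in> doubled n ?m"
    using D1(3) assms(3) doubled_mult[OF Sp_D(1)[OF D1(2)] D2(3)] by (simp add: doubled_add)
  ultimately show ?thesis
    using D2(1) Sp_mult[OF D1(2) D2(2)] by (simp add: Bog_iff series_def)
qed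

lemma modes_series [simp]: "modes (G2 \<triangleleft> G1) = modes G1"
  and scat_series [simp]: "scat (G2 \<triangleleft> G1) = scat G2 * scat G1"
  by (simp_all add: series_def)

text \<open>The scattering matrices act on the fields and never meet E. In the cross term one
  coupling stands under \<open>flat\<close> and the other does not, so it undergoes the same
  congruence as the Hamiltonians.\<close>

lemma zero_ext_series:
  assumes "G2 \<in> Bog n" "G1 \<in> Bog n" "modes G2 = modes G1"
  shows "zero_ext ms (G2 \<triangleleft> G1) = zero_ext ms G2 \<triangleleft> zero_ext ms G1"
proof -
  note dim = Bog_dim[OF assms(1)] Bog_dim[OF assms(2)]
  let ?E = "mode_emb (modes G1) ms" and ?E' = "mode_emb ms (modes G1)"
  let ?X = "flat (coup G2) * (scat G2 * coup G1)"
  have "flat (coup G2 * ?E) * scat G2 * (coup G1 * ?E) = flat ?E * (?X * ?E)"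
    using dim assms(3) by (simp add: flat_mult assoc_mult_mat_dim)
  then have 1: "Im_flat (flat (coup G2 * ?E) * scat G2 * (coup G1 * ?E)) = ?E' * (Im_flat ?X * ?E)"
    using dim assms(3) Im_flat_congruence[of ?X "length (modes G1)" ?E "length ms"]
    by (simp add: flat_mode_emb)
  have 2: "(coup G2 + scat G2 * coup G1) * ?E = coup G2 * ?E + scat G2 * (coup G1 * ?E)"
    using dim assms(3) by (simp add: mat_dim_simps)
  have 3: "?E' * ((ham G1 + ham G2 + Im_flat ?X) * ?E)
      = ?E' * (ham G1 * ?E) + ?E' * (ham G2 * ?E) + ?E' * (Im_flat ?X * ?E)"
    using dim assms(3) by (simp add: mat_dim_simps)
  have 4: "flat (coup G2) * scat G2 * coup G1 = ?X"
    using dim assms(3) by (simp add: assoc_mult_mat_dim)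
  show ?thesis
    unfolding zero_ext_eq[OF series_Bog[OF assms]] modes_series scat_series
    using 1 2 3 4 assms(3)
    by (simp add: zero_ext_eq[OF assms(1)] zero_ext_eq[OF assms(2)] series_def)
qed

text \<open>Either bracketing collects the same three pairwise cross terms: \<open>?X\<close>
  couples systems 3 and 2, \<open>?Y\<close> couples 2 and 1, and \<open>?Z\<close> couples 3 and 1
  through the scattering of 2.\<close>

lemma series_assoc:
  assumes "G3 \<in> Bog n" "G2 \<in> Bog n" "G1 \<in> Bog n" "modes G3 = modes G2" "modes G2 = modes G1"
  shows "(G3 \<triangleleft> G2) \<triangleleft> G1 = G3 \<triangleleft> (G2 \<triangleleft> G1)"
proof -
  note dim = Bog_dim[OF assms(1)] Bog_dim[OF assms(2)] Bog_dim[OF assms(3)]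
  note S3 = Sp_D[OF Bog_D(2)[OF assms(1)]]
  let ?m = "length (modes G1)"
  let ?X = "flat (coup G3) * (scat G3 * coup G2)" and ?Y = "flat (coup G2) * (scat G2 * coup G1)"
    and ?Z = "flat (coup G3) * (scat G3 * (scat G2 * coup G1))"
  \<comment> \<open>The contribution of \<open>scat G3 * coup G2\<close> loses the scattering matrix
    of \<open>G3\<close> because S3^flat S3 = 1; what remains is \<open>?Y\<close>.\<close>
  have 1: "flat (coup G3 + scat G3 * coup G2) * (scat G3 * scat G2) * coup G1 = ?Z + ?Y"
    using dim assms(4,5)
    by (simp add: mat_dim_simps flat_add flat_mult mult_mat_cancel_left[OF S3(4)])
  have 2: "flat (coup G3) * scat G3 * (coup G2 + scat G2 * coup G1) = ?X + ?Z"
    using dim assms(4,5) by (simp add: mat_dim_simps)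
  have 3: "flat (coup G3) * scat G3 * coup G2 = ?X" "flat (coup G2) * scat G2 * coup G1 = ?Y"
    using dim assms(4,5) by (simp_all add: assoc_mult_mat_dim)
  have "?X \<in> carrier_mat (2 * ?m) (2 * ?m)" "?Y \<in> carrier_mat (2 * ?m) (2 * ?m)"
    "?Z \<in> carrier_mat (2 * ?m) (2 * ?m)"
    using dim assms(4,5) by (auto intro!: carrier_matI)
  note Im = Im_flat_add[OF this(3,2)] Im_flat_add[OF this(1,3)]
  have "ham G1 + (ham G2 + ham G3 + Im_flat ?X) + (Im_flat ?Z + Im_flat ?Y)
      = ham G1 + ham G2 + Im_flat ?Y + ham G3 + (Im_flat ?X + Im_flat ?Z)"
    using dim assms(4,5) by (intro eq_matI) (simp_all add: algebra_simps)
  moreover have "coup G3 + scat G3 * coup G2 + scat G3 * scat G2 * coup G1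
      = coup G3 + scat G3 * (coup G2 + scat G2 * coup G1)"
    using dim assms(4,5) by (simp add: mat_dim_simps assoc_add_mat_dim)
  ultimately show ?thesis
    using dim assms(4,5) by (simp add: series_def 1 2 3 Im assoc_mult_mat_dim)
qed

section \<open>Static systems, the unit and inverses\<close>

lemma static_Bog: "S \<in> Sp n \<Longrightarrow> static S \<in> Bog n"
  using zero_in_doubled[of n 0] zero_in_doubled[of 0 0] flat_zero[of 0 0] Sp_D(2)[of S n]
  by (auto simp: Bog_iff static_def)

lemma scat_static [simp]: "scat (static S) = S"
  and modes_static [simp]: "modes (static S) = []"
  by (simp_all add: static_def)

lemma zero_ext_static:
  assumes "S \<in> Sp n"
  shows "zero_ext ms (static S)
    = LSys ms S (0\<^sub>m (2 * n) (2 * length ms)) (0\<^sub>m (2 * length ms) (2 * length ms))"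
  unfolding zero_ext_eq[OF static_Bog[OF assms]]
  using Sp_D(2)[OF assms] by (simp add: static_def mult_zero_mat_dim)

lemma static_one_series:
  assumes "G \<in> Bog n"
  shows "zero_ext (modes G) (static (1\<^sub>m (2 * n))) \<triangleleft> G = G"
proof -
  let ?m = "length (modes G)"
  note dim = Bog_dim[OF assms]
  have "flat (0\<^sub>m (2 * n) (2 * ?m)) * 1\<^sub>m (2 * n) * coup G = 0\<^sub>m (2 * ?m) (2 * ?m)"
    using dim by (simp add: mult_one_mat_dim mult_zero_mat_dim)
  moreover have "Im_flat (0\<^sub>m (2 * ?m) (2 * ?m)) = 0\<^sub>m (2 * ?m) (2 * ?m)"
    by (rule Im_flat_eq_zero) simp_all
  ultimately show ?thesis
    using dim
    by (cases G) (simp add: zero_ext_static[OF Sp_one] series_def mult_one_mat_dim add_zero_mat_dim)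
qed

lemma sys_inv_Bog:
  assumes "G \<in> Bog n"
  shows "sys_inv G \<in> Bog n"
proof -
  note D = Bog_D[OF assms] and dim = Bog_dim[OF assms]
  have "\<i> \<cdot>\<^sub>m (- ham G) = - (\<i> \<cdot>\<^sub>m ham G)"
    by (rule eq_matI) simp_all
  then show ?thesis
    using D dim doubled_mult[OF doubled_flat[OF Sp_D(1)[OF D(2)]] D(3)]
    by (simp add: Bog_iff sys_inv_def Sp_flat flat_uminus doubled_uminus)
qed

lemma modes_sys_inv [simp]: "modes (sys_inv G) = modes G"
  and scat_sys_inv [simp]: "scat (sys_inv G) = flat (scat G)"
  by (simp_all add: sys_inv_def)

text \<open>The couplings cancel outright. Since S S^flat = 1 the cross term collapses to - C^flat
  C, which is fixed by \<open>flat\<close> and so has no imaginary part; the Hamiltonians then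
  cancel as well.\<close>

lemma sys_inv_series:
  assumes "G \<in> Bog n"
  shows "sys_inv G \<triangleleft> G = zero_ext (modes G) (static (1\<^sub>m (2 * n)))"
proof -
  note D = Bog_D[OF assms] and dim = Bog_dim[OF assms]
  note S = Sp_D[OF D(2)]
  let ?m = "length (modes G)"
  let ?X = "flat (coup G) * coup G"
  have "flat (- (flat (scat G) * coup G)) * flat (scat G) * coup G = - ?X"
    using dim by (simp add: flat_uminus flat_mult flat_flat mat_dim_simps mult_mat_cancel_left[OF S(5)])
  moreover have "Im_flat (- ?X) = 0\<^sub>m (2 * ?m) (2 * ?m)"
    using dim by (intro Im_flat_eq_zero carrier_matI) (simp_all add: flat_uminus flat_mult flat_flat)
  moreover have "- (flat (scat G) * coup G) + flat (scat G) * coup G = 0\<^sub>m (2 * n) (2 * ?m)"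
    using dim by (intro eq_matI) simp_all
  moreover have "ham G + - ham G + 0\<^sub>m (2 * ?m) (2 * ?m) = 0\<^sub>m (2 * ?m) (2 * ?m)"
    using dim by (intro eq_matI) simp_all
  ultimately show ?thesis
    by (simp add: zero_ext_static[OF Sp_one] series_def sys_inv_def S)
qed

section \<open>Systems up to extension by zeros\<close>

text \<open>Agreement on one common list spreads to every list \<open>ms\<close>, because extending
  to \<open>ms\<close> factors through that common list.\<close>

lemma same_sys_zero_ext_eq:
  assumes "(G, H) \<in> same_sys n"
  shows "zero_ext ms G = zero_ext ms H"
proof -
  obtain ms' where *: "G \<in> Bog n" "H \<in> Bog n" "distinct ms'" "set (modes G) \<subseteq> set ms'"
    "set (modes H) \<subseteq> set ms'" "zero_ext ms' G = zero_ext ms' H"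
    using assms by (auto simp: same_sys_def)
  then show ?thesis
    by (metis zero_ext_zero_ext)
qed

lemma same_sys_Bog: "(G, H) \<in> same_sys n \<Longrightarrow> G \<in> Bog n" "(G, H) \<in> same_sys n \<Longrightarrow> H \<in> Bog n"
  by (auto simp: same_sys_def)

lemma common_modes:
  obtains ms where "distinct ms" "set ms = set ms1 \<union> set ms2"
  using finite_distinct_list[of "set ms1 \<union> set ms2"] by auto

text \<open>The premise quantifies over all common lists to match the conclusion of
  \<open>same_sys_zero_ext_eq\<close>; symmetry and transitivity of \<open>same_sys\<close> then
  reduce to those of equality.\<close>

lemma same_sysI:
  assumes "G \<in> Bog n" "H \<in> Bog n"
    "\<And>ms. distinct ms \<Longrightarrow> set (modes G) \<subseteq> set ms \<Longrightarrow> set (modes H) \<subseteq> set ms \<Longrightarrow>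
      zero_ext ms G = zero_ext ms H"
  shows "(G, H) \<in> same_sys n"
proof -
  obtain ms where "distinct ms" "set ms = set (modes G) \<union> set (modes H)"
    by (rule common_modes)
  then show ?thesis
    using assms by (auto simp: same_sys_def intro!: exI[of _ ms])
qed

lemma equiv_same_sys: "equiv (Bog n) (same_sys n)"
proof (rule equivI)
  show "same_sys n \<subseteq> Bog n \<times> Bog n"
    by (auto simp: same_sys_def)
  show "refl_on (Bog n) (same_sys n)"
    by (intro refl_onI same_sysI) auto
  show "sym (same_sys n)"
    by (rule symI) (metis same_sysI same_sys_Bog same_sys_zero_ext_eq)
  show "trans (same_sys n)"
    by (rule transI) (metis same_sysI same_sys_Bog same_sys_zero_ext_eq)
qed

lemma sys_class_eq_iff:
  "G \<in> Bog n \<Longrightarrow> H \<in> Bog n \<Longrightarrow> sys_class n G = sys_class n H \<longleftrightarrow> (G, H) \<in> same_sys n"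
  unfolding sys_class_def by (rule eq_equiv_class_iff[OF equiv_same_sys])

lemma sys_class_zero_ext:
  assumes "G \<in> Bog n" "distinct ms" "set (modes G) \<subseteq> set ms"
  shows "sys_class n (zero_ext ms G) = sys_class n G"
  using assms zero_ext_zero_ext[OF assms]
  by (subst sys_class_eq_iff) (auto intro!: same_sysI simp: zero_ext_Bog)

lemma self_in_sys_class: "G \<in> Bog n \<Longrightarrow> G \<in> sys_class n G"
  unfolding sys_class_def by (rule equiv_class_self[OF equiv_same_sys])

lemma series_same_sys:
  assumes "(G2, H2) \<in> same_sys n" "(G1, H1) \<in> same_sys n" "modes G2 = modes G1" "modes H2 = modes H1"
  shows "(G2 \<triangleleft> G1, H2 \<triangleleft> H1) \<in> same_sys n"
proof (rule same_sysI)
  note B = same_sys_Bog[OF assms(1)] same_sys_Bog[OF assms(2)]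
  show "G2 \<triangleleft> G1 \<in> Bog n" "H2 \<triangleleft> H1 \<in> Bog n"
    using B assms(3,4) by (auto intro: series_Bog)
  fix ms
  show "zero_ext ms (G2 \<triangleleft> G1) = zero_ext ms (H2 \<triangleleft> H1)"
    by (simp add: zero_ext_series[OF B(1,3) assms(3)] zero_ext_series[OF B(2,4) assms(4)]
        same_sys_zero_ext_eq[OF assms(1)] same_sys_zero_ext_eq[OF assms(2)])
qed

text \<open>The product of classes is a union over all pairs of representatives with equal mode
  lists. Every such pair yields the same class, and the given pair shows that the family is
  nonempty, so the union is that class.\<close>

lemma sys_class_mult_same_modes:
  assumes "G2 \<in> Bog n" "G1 \<in> Bog n" "modes G2 = modes G1"
  shows "sys_class n G2 \<otimes>\<^bsub>Bog_group n\<^esub> sys_class n G1 = sys_class n (G2 \<triangleleft> G1)"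
proof -
  have eq: "sys_class n (H2 \<triangleleft> H1) = sys_class n (G2 \<triangleleft> G1)"
    if "H2 \<in> sys_class n G2" "H1 \<in> sys_class n G1" "modes H2 = modes H1" for H2 H1
  proof -
    have "(G2 \<triangleleft> G1, H2 \<triangleleft> H1) \<in> same_sys n"
      using that assms(3) by (intro series_same_sys) (auto simp: sys_class_def)
    then show ?thesis
      unfolding sys_class_def using equiv_class_eq[OF equiv_same_sys] by blast
  qed
  have "{sys_class n (H2 \<triangleleft> H1) | H2 H1. H2 \<in> sys_class n G2 \<and> H1 \<in> sys_class n G1 \<and> modes H2 = modes H1}
      = {sys_class n (G2 \<triangleleft> G1)}"
    using eq self_in_sys_class[OF assms(1)] self_in_sys_class[OF assms(2)] assms(3) by blast
  then show ?thesis
    by (simp add: Bog_group_def)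
qed

lemma sys_class_mult:
  assumes "G2 \<in> Bog n" "G1 \<in> Bog n" "distinct ms" "set (modes G2) \<subseteq> set ms" "set (modes G1) \<subseteq> set ms"
  shows "sys_class n G2 \<otimes>\<^bsub>Bog_group n\<^esub> sys_class n G1
    = sys_class n (zero_ext ms G2 \<triangleleft> zero_ext ms G1)"
  using sys_class_mult_same_modes[of "zero_ext ms G2" n "zero_ext ms G1"] assms
  by (simp add: zero_ext_Bog sys_class_zero_ext)

lemma carrier_Bog_group: "carrier (Bog_group n) = sys_class n ` Bog n"
  by (auto simp: Bog_group_def quotient_def sys_class_def)

lemma one_Bog_group: "\<one>\<^bsub>Bog_group n\<^esub> = sys_class n (static (1\<^sub>m (2 * n)))"
  by (simp add: Bog_group_def)

lemma sys_inv_mult: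
  assumes "G \<in> Bog n"
  shows "sys_class n (sys_inv G) \<otimes>\<^bsub>Bog_group n\<^esub> sys_class n G = \<one>\<^bsub>Bog_group n\<^esub>"
  using Bog_D(1)[OF assms]
  by (simp add: sys_class_mult_same_modes sys_inv_Bog assms sys_inv_series[OF assms] one_Bog_group
      sys_class_zero_ext static_Bog Sp_one)

text \<open>\<open>groupI\<close> asks for a left unit and left inverses only, so the series product
  is computed just in that order.\<close>

lemma group_Bog: "group (Bog_group n :: 'l lsys set monoid)"
proof (rule groupI)
  show "\<one>\<^bsub>Bog_group n\<^esub> \<in> carrier (Bog_group n)"
    by (simp add: one_Bog_group carrier_Bog_group static_Bog Sp_one)
next
  fix X Y :: "'l lsys set"
  assume "X \<in> carrier (Bog_group n)" "Y \<in> carrier (Bog_group n)"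
  then obtain G H where GH: "G \<in> Bog n" "H \<in> Bog n" "X = sys_class n G" "Y = sys_class n H"
    by (auto simp: carrier_Bog_group)
  obtain ms where "distinct ms" "set ms = set (modes G) \<union> set (modes H)"
    by (rule common_modes)
  with GH show "X \<otimes>\<^bsub>Bog_group n\<^esub> Y \<in> carrier (Bog_group n)"
    by (auto simp: carrier_Bog_group sys_class_mult[of G n H ms] intro!: imageI series_Bog zero_ext_Bog)
next
  fix X Y Z :: "'l lsys set"
  assume "X \<in> carrier (Bog_group n)" "Y \<in> carrier (Bog_group n)" "Z \<in> carrier (Bog_group n)"
  then obtain G H K where B: "G \<in> Bog n" "H \<in> Bog n" "K \<in> Bog n"
    and eq: "X = sys_class n G" "Y = sys_class n H" "Z = sys_class n K"
    by (auto simp: carrier_Bog_group)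
  \<comment> \<open>Appending two of the mode lists lets the lemma for two lists provide a common
    list for three systems.\<close>
  obtain ms where ms: "distinct ms" "set ms = set (modes G @ modes H) \<union> set (modes K)"
    by (rule common_modes)
  define G' H' K' where "G' = zero_ext ms G" "H' = zero_ext ms H" "K' = zero_ext ms K"
  note ext = this
  have B': "G' \<in> Bog n" "H' \<in> Bog n" "K' \<in> Bog n"
    and m: "modes G' = ms" "modes H' = ms" "modes K' = ms"
    using B ms by (simp_all add: ext zero_ext_Bog)
  have "X = sys_class n G'" "Y = sys_class n H'" "Z = sys_class n K'"
    unfolding ext eq using B ms by (intro sys_class_zero_ext[symmetric]; auto)+
  then show "X \<otimes>\<^bsub>Bog_group n\<^esub> Y \<otimes>\<^bsub>Bog_group n\<^esub> Z = X \<otimes>\<^bsub>Bog_group n\<^esub> (Y \<otimes>\<^bsub>Bog_group n\<^esub> Z)"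
    using B' m series_assoc[OF B'] by (simp add: sys_class_mult_same_modes series_Bog)
next
  fix X :: "'l lsys set"
  assume "X \<in> carrier (Bog_group n)"
  then obtain G where G: "G \<in> Bog n" "X = sys_class n G"
    by (auto simp: carrier_Bog_group)
  have "sys_class n (static (1\<^sub>m (2 * n))) \<otimes>\<^bsub>Bog_group n\<^esub> X
      = sys_class n (zero_ext (modes G) (static (1\<^sub>m (2 * n))) \<triangleleft> zero_ext (modes G) G)"
    using G Bog_D(1)[OF G(1)] by (simp add: sys_class_mult static_Bog Sp_one)
  then show "\<one>\<^bsub>Bog_group n\<^esub> \<otimes>\<^bsub>Bog_group n\<^esub> X = X"
    using G by (simp add: zero_ext_self static_one_series one_Bog_group)
  show "\<exists>Y\<in>carrier (Bog_group n). Y \<otimes>\<^bsub>Bog_group n\<^esub> X = \<one>\<^bsub>Bog_group n\<^esub>"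
    using G sys_inv_mult[OF G(1)] sys_inv_Bog[OF G(1)]
    by (auto simp: carrier_Bog_group)
qed

lemma inv_sys_class:
  assumes "G \<in> Bog n"
  shows "inv\<^bsub>Bog_group n\<^esub> (sys_class n G) = sys_class n (sys_inv G)"
  using group.inv_equality[OF group_Bog sys_inv_mult[OF assms]] assms
  by (simp add: carrier_Bog_group sys_inv_Bog)

section \<open>Subgroups\<close>

lemma group_Sp: "group (Sp_group n)"
proof (rule groupI)
  fix S assume "S \<in> carrier (Sp_group n)"
  then show "\<exists>T\<in>carrier (Sp_group n). T \<otimes>\<^bsub>Sp_group n\<^esub> S = \<one>\<^bsub>Sp_group n\<^esub>"
    by (intro bexI[of _ "flat S"]) (simp_all add: Sp_group_def Sp_flat Sp_D(4))
qed (simp_all add: Sp_group_def Sp_one Sp_mult Sp_D(2)[of _ n] Sp_D(3)[of _ n] mult_one_mat_dim assoc_mult_mat_dim)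

lemma U_mats_D:
  assumes "S \<in> U_mats n"
  shows "S \<in> carrier_mat n n" "dim_row S = n" "dim_col S = n"
    "mat_adjoint S * S = 1\<^sub>m n" "S * mat_adjoint S = 1\<^sub>m n"
  using assms by (auto simp: U_mats_def)

lemma U_mats_one: "1\<^sub>m n \<in> U_mats n"
proof -
  have "mat_adjoint (1\<^sub>m n) = (1\<^sub>m n :: complex mat)"
    by (rule eq_matI) (auto simp: mat_adjoint_eq)
  then show ?thesis
    by (simp add: U_mats_def)
qed

lemma U_mats_adjoint:
  assumes "S \<in> U_mats n"
  shows "mat_adjoint S \<in> U_mats n"
  unfolding U_mats_def using U_mats_D[OF assms] by auto

lemma U_mats_mult:
  assumes "S \<in> U_mats n" "T \<in> U_mats n"
  shows "S * T \<in> U_mats n"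
proof -
  note S = U_mats_D[OF assms(1)] and T = U_mats_D[OF assms(2)]
  have "mat_adjoint (S * T) * (S * T) = mat_adjoint T * (mat_adjoint S * (S * T))"
    using S(2,3) T(2,3) by (simp add: mat_adjoint_mult assoc_mult_mat_dim)
  also have "\<dots> = 1\<^sub>m n"
    using S(2,3) T(2-4) by (simp add: mult_mat_cancel_left[OF S(4)])
  finally have 1: "mat_adjoint (S * T) * (S * T) = 1\<^sub>m n" .
  have "S * T * mat_adjoint (S * T) = S * (T * (mat_adjoint T * mat_adjoint S))"
    using S(2,3) T(2,3) by (simp add: mat_adjoint_mult assoc_mult_mat_dim)
  also have "\<dots> = 1\<^sub>m n"
    using S(2,3,5) T(2,3) by (simp add: mult_mat_cancel_left[OF T(5)])
  finally show ?thesis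
    using 1 mult_carrier_mat[OF S(1) T(1)] by (simp add: U_mats_def)
qed

lemma group_U: "group (U_group n)"
proof (rule groupI)
  fix S assume "S \<in> carrier (U_group n)"
  then show "\<exists>T\<in>carrier (U_group n). T \<otimes>\<^bsub>U_group n\<^esub> S = \<one>\<^bsub>U_group n\<^esub>"
    by (intro bexI[of _ "mat_adjoint S"]) (simp_all add: U_group_def U_mats_adjoint U_mats_D(4))
qed (simp_all add: U_group_def U_mats_one U_mats_mult U_mats_D(2)[of _ n] U_mats_D(3)[of _ n] mult_one_mat_dim assoc_mult_mat_dim)

lemma Delta_zero_mult:
  assumes "S \<in> carrier_mat n n" "T \<in> carrier_mat n n"
  shows "Delta S (0\<^sub>m n n) * Delta T (0\<^sub>m n n) = Delta (S * T) (0\<^sub>m n n)"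
  unfolding Delta_mult[OF assms(1) zero_carrier_mat assms(2) zero_carrier_mat]
  using assms by (simp add: add_zero_mat_dim mult_zero_mat_dim)

lemma flat_Delta_zero:
  assumes "S \<in> carrier_mat n n"
  shows "flat (Delta S (0\<^sub>m n n)) = Delta (mat_adjoint S) (0\<^sub>m n n)"
proof -
  have "- transpose_mat (0\<^sub>m n n) = (0\<^sub>m n n :: complex mat)"
    by auto
  then show ?thesis
    by (simp only: flat_Delta[OF assms zero_carrier_mat])
qed

lemma Delta_U_in_Sp:
  assumes "S \<in> U_mats n"
  shows "Delta S (0\<^sub>m n n) \<in> Sp n"
proof -
  note S = U_mats_D[OF assms] and S' = U_mats_D[OF U_mats_adjoint[OF assms]]
  have "Delta S (0\<^sub>m n n) \<in> doubled n n"
    by (rule Delta_in_doubled[OF S(1) zero_carrier_mat])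
  then show ?thesis
    by (simp add: Sp_eq flat_Delta_zero[OF S(1)] Delta_zero_mult[OF S(1) S'(1)]
        Delta_zero_mult[OF S'(1) S(1)] S(4,5) one_eq_Delta)
qed

lemma Delta_U_hom: "(\<lambda>S. Delta S (0\<^sub>m n n)) \<in> hom (U_group n) (Sp_group n)"
  by (rule homI) (simp_all add: U_group_def Sp_group_def Delta_U_in_Sp Delta_zero_mult[OF U_mats_D(1) U_mats_D(1)])

lemma static_series:
  assumes "S \<in> Sp n" "T \<in> Sp n"
  shows "static S \<triangleleft> static T = static (S * T)"
proof -
  have "0\<^sub>m 0 0 + 0\<^sub>m 0 0 + Im_flat X = 0\<^sub>m 0 0" if "dim_row X = 0" "dim_col X = 0" for X
    using that by (intro eq_matI) simp_all
  then show ?thesis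
    using Sp_D(2,3)[OF assms(1)] Sp_D(2,3)[OF assms(2)]
    by (simp add: series_def static_def mult_zero_mat_dim add_zero_mat_dim)
qed

text \<open>Static systems all have the empty mode list, so their classes multiply without any
  extension.\<close>

lemma static_hom: "(\<lambda>S. sys_class n (static S)) \<in> hom (Sp_group n) (Bog_group n)"
  by (rule homI)
    (simp_all add: Sp_group_def carrier_Bog_group static_Bog sys_class_mult_same_modes static_series)

text \<open>Extension by zeros leaves the scattering matrix alone, so it is an invariant of the
  class.\<close>

lemma inj_static: "inj_on (\<lambda>S. sys_class n (static S)) (Sp n)"
proof (rule inj_onI)
  fix S T
  assume "S \<in> Sp n" "T \<in> Sp n" "sys_class n (static S :: 'l lsys) = sys_class n (static T)"
  then have "(static S :: 'l lsys, static T) \<in> same_sys n"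
    by (simp add: sys_class_eq_iff static_Bog)
  from same_sys_zero_ext_eq[OF this] show "S = T"
    by (metis scat_zero_ext scat_static)
qed

lemma inj_Delta_U: "inj_on (\<lambda>S. Delta S (0\<^sub>m n n)) (U_mats n)"
  by (rule inj_onI) (auto elim: Delta_inject(1)[of _ _ _ _ n n] dest: U_mats_D(1))

lemma HP_iff: "G \<in> HP n \<longleftrightarrow> G \<in> Bog n \<and> (\<exists>S\<in>U_mats n. scat G = Delta S (0\<^sub>m n n))"
  by (auto simp: HP_def HP_nm_def Bog_def)

text \<open>Within \<open>Bog n\<close> the class \<open>HP n\<close> restricts the scattering
  matrix alone. The series product multiplies these matrices and inversion applies
  \<open>flat\<close>, which on block-diagonal unitaries is the adjoint.\<close>

lemma subgroup_HP: "subgroup (sys_class n ` (HP n :: 'l lsys set)) (Bog_group n)"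
proof (rule subgroup.intro)
  show "sys_class n ` (HP n :: 'l lsys set) \<subseteq> carrier (Bog_group n)"
    by (auto simp: carrier_Bog_group HP_iff)
  have "(static (1\<^sub>m (2 * n)) :: 'l lsys) \<in> HP n"
    using static_Bog[OF Sp_one] U_mats_one by (auto simp: HP_iff one_eq_Delta)
  then show "\<one>\<^bsub>Bog_group n\<^esub> \<in> sys_class n ` (HP n :: 'l lsys set)"
    by (simp add: one_Bog_group)
next
  fix X Y :: "'l lsys set"
  assume "X \<in> sys_class n ` HP n" "Y \<in> sys_class n ` HP n"
  then obtain G H S T where *: "G \<in> Bog n" "H \<in> Bog n" "X = sys_class n G" "Y = sys_class n H"
    "S \<in> U_mats n" "T \<in> U_mats n" "scat G = Delta S (0\<^sub>m n n)" "scat H = Delta T (0\<^sub>m n n)"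
    by (auto simp: HP_iff)
  obtain ms where ms: "distinct ms" "set ms = set (modes G) \<union> set (modes H)"
    by (rule common_modes)
  have "zero_ext ms G \<triangleleft> zero_ext ms H \<in> HP n"
    using * ms Delta_zero_mult[OF U_mats_D(1) U_mats_D(1)] U_mats_mult
    by (auto simp: HP_iff intro!: series_Bog zero_ext_Bog)
  with * ms show "X \<otimes>\<^bsub>Bog_group n\<^esub> Y \<in> sys_class n ` HP n"
    by (simp add: sys_class_mult[of G n H ms])
next
  fix X :: "'l lsys set"
  assume "X \<in> sys_class n ` HP n"
  then obtain G S where *: "G \<in> Bog n" "X = sys_class n G" "S \<in> U_mats n" "scat G = Delta S (0\<^sub>m n n)"
    by (auto simp: HP_iff)
  then have "sys_inv G \<in> HP n"
    using flat_Delta_zero[OF U_mats_D(1)] U_mats_adjoint sys_inv_Bog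
    by (auto simp: HP_iff)
  with * show "inv\<^bsub>Bog_group n\<^esub> X \<in> sys_class n ` HP n"
    by (simp add: inv_sys_class)
qed

section \<open>Transfer functions\<close>

text \<open>The result \<open>None\<close> would say that A is not a unit of the matrix ring; any
  result \<open>Some C\<close> is a right inverse and thus equals the two-sided inverse B.\<close>

lemma mat_inverse_eqI:
  assumes "A \<in> carrier_mat n n" "B \<in> carrier_mat n n" "A * B = 1\<^sub>m n" "B * A = 1\<^sub>m n"
  shows "mat_inverse A = Some B"
proof (cases "mat_inverse A")
  case None
  from mat_inverse(1)[OF assms(1) this] assms show ?thesis
    by (auto simp: Units_def ring_mat_def)
next
  case (Some C)
  from mat_inverse(2)[OF assms(1) this] have C: "A * C = 1\<^sub>m n" "C \<in> carrier_mat n n"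
    by auto
  have "B = B * (A * C)"
    using assms(2) C by (simp add: mult_one_mat_dim)
  also have "\<dots> = B * A * C"
    using assms(1,2) C(2) by (simp add: assoc_mult_mat_dim)
  also have "\<dots> = C"
    using assms(4) C(2) by (simp add: mult_one_mat_dim)
  finally show ?thesis
    using Some by simp
qed

lemma mat_inverse_flat:
  assumes A: "A \<in> carrier_mat (2 * m) (2 * m)"
  shows "mat_inverse (flat A) = map_option flat (mat_inverse A)"
proof -
  have *: "mat_inverse (flat A) = Some (flat B)"
    if A: "A \<in> carrier_mat (2 * m) (2 * m)" and inv: "mat_inverse A = Some B" for A B
  proof -
    note B = mat_inverse(2)[OF A inv]
    have "flat A * flat B = flat (B * A)" "flat B * flat A = flat (A * B)"
      using A B by (intro flat_mult[symmetric]; auto)+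
    with A B show ?thesis
      by (intro mat_inverse_eqI[of _ "2 * m"]) (auto intro: flat_carrier)
  qed
  show ?thesis
  proof (cases "mat_inverse A")
    case None
    \<comment> \<open>An inverse of \<open>flat A\<close> would give one of
      \<open>flat (flat A)\<close>, which is A itself.\<close>
    have "mat_inverse (flat A) = None"
    proof (rule ccontr)
      assume "mat_inverse (flat A) \<noteq> None"
      then obtain B where "mat_inverse (flat A) = Some B"
        by auto
      from *[OF flat_carrier[OF A] this] A None show False
        by (simp add: flat_flat)
    qed
    with None show ?thesis by simp
  next
    case (Some B)
    with *[OF A] show ?thesis by simp
  qed
qed

text \<open>As an equation of options this includes that both sides are defined at the same points.
  The drift matrix of the inverse is A^flat: S S^flat = 1 keeps C^flat C unchanged, and the
  antilinear \<open>flat\<close> changes the sign of i Omega as the inverse does.\<close>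

lemma transfer_sys_inv:
  assumes "G \<in> Bog n"
  shows "transfer (sys_inv G) s = map_option flat (transfer G (cnj s))"
proof -
  note D = Bog_D[OF assms] and dim = Bog_dim[OF assms]
  note S = Sp_D[OF D(2)]
  let ?m = "length (modes G)"
  let ?C = "coup G" and ?S = "scat G"
  let ?M = "cnj s \<cdot>\<^sub>m 1\<^sub>m (2 * ?m) - A_mat G"
  have Cinv: "flat (- (flat ?S * ?C)) = - (flat ?C * ?S)"
    using dim by (simp add: flat_uminus flat_mult flat_flat)
  have "flat (- (flat ?S * ?C)) * - (flat ?S * ?C) = flat ?C * ?C"
    unfolding Cinv using dim by (simp add: mat_dim_simps mult_mat_cancel_left[OF S(5)])
  then have A: "A_mat (sys_inv G) = (- (1 / 2)) \<cdot>\<^sub>m (flat ?C * ?C) + \<i> \<cdot>\<^sub>m ham G"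
    using dim by (intro eq_matI) (simp_all add: A_mat_def sys_inv_def)
  have "flat ?M = s \<cdot>\<^sub>m 1\<^sub>m (2 * ?m) - ((- (1 / 2)) \<cdot>\<^sub>m (flat ?C * ?C) - (- \<i>) \<cdot>\<^sub>m ham G)"
    using dim D(5) by (simp add: A_mat_def flat_minus flat_smult flat_mult flat_flat)
  also have "\<dots> = s \<cdot>\<^sub>m 1\<^sub>m (2 * ?m) - A_mat (sys_inv G)"
    unfolding A using dim by (intro eq_matI) simp_all
  finally have fM: "s \<cdot>\<^sub>m 1\<^sub>m (2 * length (modes (sys_inv G))) - A_mat (sys_inv G) = flat ?M"
    by simp
  have M: "?M \<in> carrier_mat (2 * ?m) (2 * ?m)"
    using dim by (auto simp: A_mat_def)
  \<comment> \<open>The signs of the two couplings cancel, and the trailing S S^flat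
    disappears.\<close>
  have "flat ?S - (- (flat ?S * ?C)) * flat R * flat (- (flat ?S * ?C)) * flat ?S
      = flat (?S - ?C * R * flat ?C * ?S)" if R: "mat_inverse ?M = Some R" for R
  proof -
    have "dim_row R = 2 * ?m" "dim_col R = 2 * ?m"
      using mat_inverse(2)[OF M R] by auto
    then show ?thesis
      unfolding Cinv using dim
      by (simp add: flat_minus flat_mult flat_flat mat_dim_simps S(5) mult_one_mat_dim)
  qed
  then show ?thesis
    unfolding transfer_def fM mat_inverse_flat[OF M]
    by (auto simp: sys_inv_def option.map_comp intro!: map_option_cong[OF refl])
qed

section \<open>Transfer functions of different representatives\<close>

text \<open>At a point where the resolvent of \<open>G\<close> exists the resolvent of a zero extension need not
  exist (the additional modes are singular at \<open>s = 0\<close>), but \<open>Y\<close> and \<open>Z\<close> still play the roles of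
  its products with the input and output matrices.\<close>

lemma transfer_zero_ext:
  fixes G :: "'l lsys" and ms :: "'l list" and s :: complex
  defines "M \<equiv> s \<cdot>\<^sub>m 1\<^sub>m (2 * length ms) - A_mat (zero_ext ms G)" and "C \<equiv> coup (zero_ext ms G)"
  assumes G: "G \<in> Bog n" and ms: "distinct ms" "set (modes G) \<subseteq> set ms"
    and X: "transfer G s = Some X"
  obtains Y Z where "dim_row Y = 2 * length ms" "dim_col Y = 2 * n"
    "dim_row Z = 2 * n" "dim_col Z = 2 * length ms"
    "M * Y = flat C" "Z * M = C" "X = scat G - C * Y * scat G"
proof -
  note dim = Bog_dim[OF G]
  let ?m = "length (modes G)" and ?k = "length ms"
  let ?E = "mode_emb (modes G) ms" and ?E' = "mode_emb ms (modes G)"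
  let ?M = "s \<cdot>\<^sub>m 1\<^sub>m (2 * ?m) - A_mat G"
  obtain R where R: "mat_inverse ?M = Some R" and XR: "X = scat G - coup G * R * flat (coup G) * scat G"
    using X by (auto simp: transfer_def)
  have M_carrier: "?M \<in> carrier_mat (2 * ?m) (2 * ?m)"
    using dim by (auto simp: A_mat_def)
  from mat_inverse(2)[OF M_carrier R]
  have R': "?M * R = 1\<^sub>m (2 * ?m)" "R * ?M = 1\<^sub>m (2 * ?m)" "dim_row R = 2 * ?m" "dim_col R = 2 * ?m"
    by auto
  have EE': "?E * ?E' = 1\<^sub>m (2 * ?m)"
    using mode_emb_mult[of ms "modes G" "modes G"] ms mode_emb_self[OF Bog_D(1)[OF G]] by simp
  note E = mult_mat_cancel_left[OF EE']
  have dimA: "dim_row (A_mat G) = 2 * ?m" "dim_col (A_mat G) = 2 * ?m"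
    using dim by (simp_all add: A_mat_def)
  have C: "C = coup G * ?E"
    by (simp add: C_def zero_ext_eq[OF G])
  have A: "A_mat (zero_ext ms G) = ?E' * (A_mat G * ?E)"
    using dim by (simp add: A_mat_def zero_ext_eq[OF G] flat_mult flat_mode_emb mat_dim_simps)
  \<comment> \<open>Since the extended drift matrix is E^flat A E and E E^flat = 1, both
    \<open>?E'\<close> and \<open>?E\<close> intertwine M with the matrix \<open>?M\<close> of the
    original system.\<close>
  have ME': "M * ?E' = ?E' * ?M"
    unfolding M_def A using dimA by (simp add: mat_dim_simps EE' mult_one_mat_dim)
  have EM: "?E * M = ?M * ?E"
    unfolding M_def A using dimA by (simp add: mat_dim_simps E mult_one_mat_dim)
  have dimM: "dim_row M = 2 * ?k" "dim_col M = 2 * ?k"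
    by (simp_all add: M_def A)
  \<comment> \<open>If M were invertible, these would be M^-1 C^flat and C M^-1 for the extended
    coupling C; written through the resolvent R of the original system they exist even when M is
    singular.\<close>
  let ?Y = "?E' * (R * flat (coup G))" and ?Z = "coup G * R * ?E"
  show ?thesis
  proof
    have "M * ?Y = M * ?E' * (R * flat (coup G))"
      using dim dimM R'(3,4) by (simp add: assoc_mult_mat_dim)
    also have "\<dots> = ?E' * (?M * (R * flat (coup G)))"
      unfolding ME' using dim dimA R'(3,4) by (simp add: assoc_mult_mat_dim)
    also have "?M * (R * flat (coup G)) = flat (coup G)"
      using dim dimA R'(3,4) by (intro mult_mat_cancel_left[OF R'(1)]) simp_all
    finally show "M * ?Y = flat C"
      using dim by (simp add: C flat_mult flat_mode_emb)
    have "?Z * M = coup G * (R * (?E * M))"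
      using dim dimM R'(3,4) by (simp add: assoc_mult_mat_dim)
    also have "R * (?E * M) = ?E"
      unfolding EM using dimA R'(3,4) by (intro mult_mat_cancel_left[OF R'(2)]) simp_all
    finally show "?Z * M = C"
      by (simp add: C)
    show "X = scat G - C * ?Y * scat G"
      unfolding XR C using dim R'(3,4) by (simp add: assoc_mult_mat_dim E)
  qed (use dim in simp_all)
qed

text \<open>On a common list the two values differ at most through the solutions P and P' of one
  possibly singular equation. The row solution Z removes the ambiguity: C P = Z M P = Z C^flat = Z M
  P' = C P'.\<close>

lemma transfer_same_sys:
  assumes "(G, H) \<in> same_sys n" "transfer G s = Some X" "transfer H s = Some Y"
  shows "X = Y"
proof -
  note B = same_sys_Bog[OF assms(1)]
  obtain ms where ms: "distinct ms" "set ms = set (modes G) \<union> set (modes H)"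
    by (rule common_modes)
  have eq: "zero_ext ms G = zero_ext ms H"
    by (rule same_sys_zero_ext_eq[OF assms(1)])
  have scat: "scat G = scat H"
    using eq by (metis scat_zero_ext)
  let ?M = "s \<cdot>\<^sub>m 1\<^sub>m (2 * length ms) - A_mat (zero_ext ms H)" and ?C = "coup (zero_ext ms H)"
  have A: "dim_row (A_mat (zero_ext ms H)) = 2 * length ms" "dim_col (A_mat (zero_ext ms H)) = 2 * length ms"
    using Bog_dim[OF zero_ext_Bog[OF B(2) ms(1)]] by (simp_all add: A_mat_def)
  obtain P Q where PQ: "dim_row P = 2 * length ms" "dim_col P = 2 * n"
    "?M * P = flat ?C" "X = scat H - ?C * P * scat H"
    using transfer_zero_ext[OF B(1) ms(1) _ assms(2)] ms(2) unfolding eq scat by blast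
  obtain P' Z where PZ: "dim_row P' = 2 * length ms" "dim_col P' = 2 * n"
    "dim_row Z = 2 * n" "dim_col Z = 2 * length ms"
    "?M * P' = flat ?C" "Z * ?M = ?C" "Y = scat H - ?C * P' * scat H"
    using transfer_zero_ext[OF B(2) ms(1) _ assms(3)] ms(2) by blast
  have "Z * ?M * P = Z * (?M * P)" "Z * ?M * P' = Z * (?M * P')"
    using PQ(1) PZ(1,4) A by (simp_all add: assoc_mult_mat_dim)
  then have "?C * P = ?C * P'"
    unfolding PZ(6) PQ(3) PZ(5) by simp
  then show ?thesis
    by (simp add: PQ(4) PZ(7))
qed

text \<open>The sort \<open>infinite\<close> guarantees enough mode names for systems of every size.
  The last conjunct covers all representatives H of the inverse class, which may carry extra modes
  that are singular at s = 0.\<close>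

theorem mainTheorem6:
  fixes n :: nat
  assumes "n \<ge> 1"
  shows "group (Bog_group n :: ('l::infinite) lsys set monoid)
    \<and> (\<forall>(G2::'l lsys) \<in> Bog n. \<forall>G1 \<in> Bog n. \<forall>ms.
          distinct ms \<and> set (modes G2) \<subseteq> set ms \<and> set (modes G1) \<subseteq> set ms \<longrightarrow>
          sys_class n G2 \<otimes>\<^bsub>Bog_group n\<^esub> sys_class n G1
            = sys_class n (zero_ext ms G2 \<triangleleft> zero_ext ms G1))
    \<and> subgroup (sys_class n ` (HP n :: 'l lsys set)) (Bog_group n)
    \<and> subgroup ((\<lambda>S. sys_class n (static S :: 'l lsys)) ` Sp n) (Bog_group n)
    \<and> (\<lambda>S. sys_class n (static S :: 'l lsys)) \<in> hom (Sp_group n) (Bog_group n)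
    \<and> inj_on (\<lambda>S. sys_class n (static S :: 'l lsys)) (Sp n)
    \<and> subgroup ((\<lambda>S. sys_class n (static (Delta S (0\<^sub>m n n)) :: 'l lsys)) ` U_mats n) (Bog_group n)
    \<and> (\<lambda>S. sys_class n (static (Delta S (0\<^sub>m n n)) :: 'l lsys)) \<in> hom (U_group n) (Bog_group n)
    \<and> inj_on (\<lambda>S. sys_class n (static (Delta S (0\<^sub>m n n)) :: 'l lsys)) (U_mats n)
    \<and> (\<forall>(G::'l lsys) \<in> Bog n.
          sys_inv G \<in> Bog n
          \<and> inv\<^bsub>Bog_group n\<^esub> (sys_class n G) = sys_class n (sys_inv G)
          \<and> (\<forall>s. transfer (sys_inv G) s = map_option flat (transfer G (cnj s)))
          \<and> (\<forall>H \<in> inv\<^bsub>Bog_group n\<^esub> (sys_class n G). \<forall>s X Y.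
                transfer H s = Some X \<and> transfer G (cnj s) = Some Y \<longrightarrow> X = flat Y))"
proof -
  let ?static = "\<lambda>S. sys_class n (static S :: 'l lsys)"
  let ?U = "\<lambda>S. Delta S (0\<^sub>m n n)"
  have homU: "(\<lambda>S. ?static (?U S)) \<in> hom (U_group n) (Bog_group n)"
    using Group.hom_compose[OF Delta_U_hom static_hom] by (simp add: comp_def)
  \<comment> \<open>The copies of Sp and U are images of group homomorphisms and hence
    subgroups.\<close>
  have "group_hom (Sp_group n) (Bog_group n) ?static"
    by (intro group_hom.intro group_Sp group_Bog group_hom_axioms.intro static_hom)
  from group_hom.img_is_subgroup[OF this] have subSp: "subgroup (?static ` Sp n) (Bog_group n)"
    by (simp add: Sp_group_def)
  have "group_hom (U_group n) (Bog_group n) (\<lambda>S. ?static (?U S))"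
    by (intro group_hom.intro group_U group_Bog group_hom_axioms.intro homU)
  from group_hom.img_is_subgroup[OF this]
  have subU: "subgroup ((\<lambda>S. ?static (?U S)) ` U_mats n) (Bog_group n)"
    by (simp add: U_group_def)
  have injU: "inj_on (\<lambda>S. ?static (?U S)) (U_mats n)"
  proof (rule inj_onI)
    fix S T
    assume "S \<in> U_mats n" "T \<in> U_mats n" "?static (?U S) = ?static (?U T)"
    then show "S = T"
      using inj_onD[OF inj_static] inj_onD[OF inj_Delta_U] Delta_U_in_Sp by metis
  qed
  have X: "X = flat Y"
    if "G \<in> Bog n" "H \<in> inv\<^bsub>Bog_group n\<^esub> (sys_class n G)" "transfer H s = Some X"
      "transfer G (cnj s) = Some Y" for G H :: "'l lsys" and s X Y
  proof -
    have "H \<in> sys_class n (sys_inv G)"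
      using that(1,2) by (simp add: inv_sys_class)
    then have "(sys_inv G, H) \<in> same_sys n"
      by (simp add: sys_class_def)
    from transfer_same_sys[OF this _ that(3)] show ?thesis
      using that(4) by (simp add: transfer_sys_inv[OF that(1)])
  qed
  show ?thesis
    by (intro conjI ballI allI impI; (elim conjE)?;
        (fact group_Bog subgroup_HP subSp static_hom inj_static subU homU injU
        | rule sys_class_mult sys_inv_Bog inv_sys_class transfer_sys_inv X, assumption+))
qed

end
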